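(* For every real $h>0$: the pyramid $P_4(h)$ has trivial Dehn invariant if and only if $h=1/\sqrt{2}$; moreover $P_4(h)$ is rational (all its dihedral angles are rational multiples of $\pi$) if and only if $h=1/\sqrt{2}$. Furthermore, for every $h>0$, the pyramids $P_3(h)$ and $P_6(h)$ have non-trivial Dehn invariant, i.e. they are never scissor equivalent to a cube.
   Context: Identify $\mathbb{C}$ with the horizontal plane $\{z=0\}$ of $\mathbb{R}^3$. For an integer $n\ge 3$ and a real $h>0$, $P_n(h)$ denotes the pyramid in $\mathbb{R}^3$ which is the convex hull of the $n$ complex $n$-th roots of unity (a regular $n$-gon in the horizontal plane centered at the origin $O$) and the apex $S=(0,0,h)$, so $h=OS$ is its height. The Dehn invariant of a polyhedron $P$ is $\mathrm{Dehn}(P)=\sum_{e}\ell(e)\otimes\theta(e)\in\mathbb{R}\otimes_{\mathbb{Z}}\mathbb{R}/\pi\mathbb{Z}$, the sum over the edges $e$ of $P$, where $\ell(e)$ is the length of $e$ and $\theta(e)$ the interior dihedral angle of $P$ along $e$. A polyhedron is scissor equivalent to a cube (of the same volume) if and only if its Dehn invariant is zero. A polyhedron is called rational if all its dihedral angles are rational multiples of $\pi$. *)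

theory Defs
  imports "HOL-Analysis.Analysis" "HOL-Library.Poly_Mapping"
begin

section \<open>The tensor product of abelian groups\<close>

text \<open>
  The tensor product over the integers is the free abelian group on \<open>'a \<times> 'b\<close>
  (finitely supported integer-valued functions) modulo the subgroup generated by the
  bilinearity relations.
\<close>

inductive_set bilinear_relations :: "('a::ab_group_add \<times> 'b::ab_group_add \<Rightarrow>\<^sub>0 int) set" where
  zero: "0 \<in> bilinear_relations"
| diff: "x \<in> bilinear_relations \<Longrightarrow> y \<in> bilinear_relations \<Longrightarrow> x - y \<in> bilinear_relations"
| left: "Poly_Mapping.single (a + a', b) 1 - Poly_Mapping.single (a, b) 1
           - Poly_Mapping.single (a', b) 1 \<in> bilinear_relations"
| right: "Poly_Mapping.single (a, b + b') 1 - Poly_Mapping.single (a, b) 1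
           - Poly_Mapping.single (a, b') 1 \<in> bilinear_relations"

lemma bilinear_relations_uminus:
  "x \<in> bilinear_relations \<Longrightarrow> - x \<in> bilinear_relations"
  using bilinear_relations.diff[OF bilinear_relations.zero, of x] by simp

lemma bilinear_relations_add:
  "x \<in> bilinear_relations \<Longrightarrow> y \<in> bilinear_relations \<Longrightarrow> x + y \<in> bilinear_relations"
  using bilinear_relations.diff[OF _ bilinear_relations_uminus, of x y] by simp

definition tensor_rel ::
  "('a::ab_group_add \<times> 'b::ab_group_add \<Rightarrow>\<^sub>0 int) \<Rightarrow> ('a \<times> 'b \<Rightarrow>\<^sub>0 int) \<Rightarrow> bool" where
  "tensor_rel x y \<longleftrightarrow> x - y \<in> bilinear_relations"

lemma equivp_tensor_rel: "equivp tensor_rel"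
proof (rule equivpI)
  show "reflp tensor_rel"
    by (simp add: reflp_def tensor_rel_def bilinear_relations.zero)
  show "symp tensor_rel"
    unfolding symp_def tensor_rel_def
    using bilinear_relations_uminus by fastforce
  show "transp tensor_rel"
    unfolding transp_def tensor_rel_def
    using bilinear_relations_add by fastforce
qed

quotient_type (overloaded) ('a, 'b) tensor_product =
  "('a::ab_group_add \<times> 'b::ab_group_add) \<Rightarrow>\<^sub>0 int" / tensor_rel
  by (rule equivp_tensor_rel)

instantiation tensor_product :: (ab_group_add, ab_group_add) ab_group_add
begin

lift_definition zero_tensor_product :: "('a, 'b) tensor_product" is 0 .

lift_definition plus_tensor_product ::
  "('a, 'b) tensor_product \<Rightarrow> ('a, 'b) tensor_product \<Rightarrow> ('a, 'b) tensor_product" is "(+)"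
  unfolding tensor_rel_def by (simp add: add_diff_add bilinear_relations_add)

lift_definition uminus_tensor_product ::
  "('a, 'b) tensor_product \<Rightarrow> ('a, 'b) tensor_product" is uminus
  unfolding tensor_rel_def by (simp only: minus_diff_minus bilinear_relations_uminus)

lift_definition minus_tensor_product ::
  "('a, 'b) tensor_product \<Rightarrow> ('a, 'b) tensor_product \<Rightarrow> ('a, 'b) tensor_product" is "(-)"
proof -
  fix x x' y y' :: "'a \<times> 'b \<Rightarrow>\<^sub>0 int"
  assume "tensor_rel x x'" "tensor_rel y y'"
  moreover have "x - y - (x' - y') = (x - x') - (y - y')"
    by simp
  ultimately show "tensor_rel (x - y) (x' - y')"
    unfolding tensor_rel_def by (simp only: bilinear_relations.diff)
qed

instance
  by standard (transfer, simp add: tensor_rel_def bilinear_relations.zero algebra_simps)+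

end

lift_definition tensor :: "'a::ab_group_add \<Rightarrow> 'b::ab_group_add \<Rightarrow> ('a, 'b) tensor_product"
  (infixr \<open>\<otimes>\<^sub>\<int>\<close> 75)
  is "\<lambda>a b. Poly_Mapping.single (a, b) 1" .


section \<open>Angles modulo \<open>\<pi>\<close>\<close>

definition cong_pi :: "real \<Rightarrow> real \<Rightarrow> bool" where
  "cong_pi x y \<longleftrightarrow> (\<exists>k::int. x - y = of_int k * pi)"

lemma equivp_cong_pi: "equivp cong_pi"
proof (rule equivpI)
  show "reflp cong_pi"
    by (auto simp: reflp_def cong_pi_def intro: exI[of _ 0])
  show "symp cong_pi"
    unfolding symp_def cong_pi_def
  proof safe
    fix x y :: real and k :: int
    assume "x - y = of_int k * pi"
    then have "y - x = of_int (- k) * pi" by simp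
    then show "\<exists>k::int. y - x = of_int k * pi" by blast
  qed
  show "transp cong_pi"
    unfolding transp_def cong_pi_def
  proof safe
    fix x y z :: real and k l :: int
    assume "x - y = of_int k * pi" "y - z = of_int l * pi"
    then have "x - z = of_int (k + l) * pi" by (simp add: algebra_simps)
    then show "\<exists>k::int. x - z = of_int k * pi" by blast
  qed
qed

quotient_type angle_mod_pi = real / cong_pi
  by (rule equivp_cong_pi)

instantiation angle_mod_pi :: ab_group_add
begin

lift_definition zero_angle_mod_pi :: angle_mod_pi is 0 .

lift_definition plus_angle_mod_pi :: "angle_mod_pi \<Rightarrow> angle_mod_pi \<Rightarrow> angle_mod_pi" is "(+)"
  unfolding cong_pi_def
proof safe
  fix x x' y y' :: real and k l :: int
  assume "x - x' = of_int k * pi" "y - y' = of_int l * pi"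
  then have "x + y - (x' + y') = of_int (k + l) * pi" by (simp add: algebra_simps)
  then show "\<exists>k::int. x + y - (x' + y') = of_int k * pi" by blast
qed

lift_definition uminus_angle_mod_pi :: "angle_mod_pi \<Rightarrow> angle_mod_pi" is uminus
  unfolding cong_pi_def
proof safe
  fix x y :: real and k :: int
  assume "x - y = of_int k * pi"
  then have "- x - - y = of_int (- k) * pi" by simp
  then show "\<exists>k::int. - x - - y = of_int k * pi" by blast
qed

lift_definition minus_angle_mod_pi :: "angle_mod_pi \<Rightarrow> angle_mod_pi \<Rightarrow> angle_mod_pi" is "(-)"
  unfolding cong_pi_def
proof safe
  fix x x' y y' :: real and k l :: int
  assume "x - x' = of_int k * pi" "y - y' = of_int l * pi"
  then have "x - y - (x' - y') = of_int (k - l) * pi" by (simp add: algebra_simps)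
  then show "\<exists>k::int. x - y - (x' - y') = of_int k * pi" by blast
qed

instance
  by standard (transfer, simp add: cong_pi_def algebra_simps)+

end

lift_definition mod_pi :: "real \<Rightarrow> angle_mod_pi" is "\<lambda>x. x" .


section \<open>Dihedral angles and the Dehn invariant of convex polytopes\<close>

text \<open>
  \<open>inward_direction e F u\<close>: the unit vector \<open>u\<close> is orthogonal to the edge \<open>e\<close> and points
  from \<open>e\<close> into the facet \<open>F\<close> containing it.
\<close>

definition inward_direction :: "(real^3) set \<Rightarrow> (real^3) set \<Rightarrow> real^3 \<Rightarrow> bool" where
  "inward_direction e F u \<longleftrightarrow>
     norm u = 1 \<and> (\<forall>x\<in>e. \<forall>y\<in>e. u \<bullet> (x - y) = 0) \<and> (\<exists>x\<in>e. \<exists>t>0. x + t *\<^sub>R u \<in> F)"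

text \<open>
  An edge of a 3-dimensional convex polytope lies in exactly two facets, and by convexity the
  interior dihedral angle there is the unoriented angle, in \<open>(0, \<pi>)\<close>, between the two facets.
\<close>

definition dihedral_angle :: "(real^3) set \<Rightarrow> (real^3) set \<Rightarrow> real" where
  "dihedral_angle P e =
     (THE \<theta>. \<exists>F G u v. F facet_of P \<and> G facet_of P \<and> F \<noteq> G \<and> e \<subseteq> F \<and> e \<subseteq> G \<and>
        inward_direction e F u \<and> inward_direction e G v \<and> \<theta> = arccos (u \<bullet> v))"

text \<open>Edges are segments, so their length is their diameter.\<close>

definition dehn :: "(real^3) set \<Rightarrow> (real, angle_mod_pi) tensor_product" where
  "dehn P = (\<Sum>e | e edge_of P. diameter e \<otimes>\<^sub>\<int> mod_pi (dihedral_angle P e))"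

definition rational_polytope :: "(real^3) set \<Rightarrow> bool" where
  "rational_polytope P \<longleftrightarrow> (\<forall>e. e edge_of P \<longrightarrow> (\<exists>q\<in>\<rat>. dihedral_angle P e = q * pi))"


section \<open>Scissor equivalence\<close>

definition dissects :: "(real^3) set set \<Rightarrow> (real^3) set \<Rightarrow> bool" where
  "dissects D P \<longleftrightarrow>
     finite D \<and> (\<forall>Q\<in>D. polytope Q \<and> interior Q \<noteq> {}) \<and>
     pairwise (\<lambda>A B. interior A \<inter> interior B = {}) D \<and> \<Union> D = P"

definition congruent_sets :: "(real^3) set \<Rightarrow> (real^3) set \<Rightarrow> bool" where
  "congruent_sets A B \<longleftrightarrow> (\<exists>f. (\<forall>x y. dist (f x) (f y) = dist x y) \<and> f ` A = B)"

definition scissor_equivalent :: "(real^3) set \<Rightarrow> (real^3) set \<Rightarrow> bool" where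
  "scissor_equivalent P Q \<longleftrightarrow>
     (\<exists>D E g. dissects D P \<and> dissects E Q \<and> bij_betw g D E \<and> (\<forall>A\<in>D. congruent_sets A (g A)))"

text \<open>Up to congruence, every cube is axis-parallel.\<close>

definition cube :: "real \<Rightarrow> (real^3) set" where
  "cube s = cbox 0 (\<chi> i. s)"

definition scissor_equivalent_to_cube :: "(real^3) set \<Rightarrow> bool" where
  "scissor_equivalent_to_cube P \<longleftrightarrow> (\<exists>s>0. scissor_equivalent P (cube s))"


section \<open>The pyramids\<close>

definition pyramid :: "nat \<Rightarrow> real \<Rightarrow> (real^3) set" where
  "pyramid n h =
     convex hull (insert (vector [0, 0, h]) {vector [Re z, Im z, 0] | z::complex. z ^ n = 1})"

end

theory Submission
  imports Defs
begin

text \<open>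
  With base dihedral angle \<open>\<alpha>\<close>, lateral dihedral angle \<open>\<beta>\<close>, base edges of length \<open>a\<close> and lateral
  edges of length \<open>b\<close>, the Dehn invariant is \<open>n a \<otimes> \<alpha> + n b \<otimes> \<beta>\<close>. Testing it against rational-linear
  functionals shows that it vanishes only if both angles are rational multiples of \<open>\<pi>\<close>, or
  \<open>b / a = p / q\<close> is rational and \<open>q \<alpha> + p \<beta>\<close> is a rational multiple of \<open>\<pi>\<close>.

  In the first case the relation between \<open>cos \<alpha>\<close> and \<open>cos \<beta>\<close> makes \<open>2 cos (2 \<alpha>)\<close> twice a cyclotomic
  integer, which forces \<open>\<alpha> = \<pi> / 4\<close>; for \<open>n = 3, 6\<close> the number \<open>2 cos \<beta>\<close> is then a half-integer, which
  is not integral.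

  In the second case \<open>\<alpha>\<close> and \<open>\<beta>\<close> are arguments of integers \<open>w\<close>, \<open>V\<close> of one imaginary quadratic field.
  A prime \<open>l\<close> dividing \<open>2 p + q\<close> can be chosen that divides the norm but not the trace of \<open>w\<close>, and such
  that \<open>V\<close> is congruent modulo \<open>l\<close> to a nonzero integer multiple of \<open>w\<close>. Then \<open>w ^ A * V ^ B\<close> is again
  such a multiple modulo \<open>l\<close>, so it is never real. The value \<open>p / q = 5 / 2\<close> for \<open>n = 6\<close> is treated
  separately.
\<close>

section \<open>Cyclotomic integers\<close>

text \<open>Why such a prime decides: if \<open>l\<close> divides the norm but not the trace
  \<open>T\<close> of \<open>w\<close>, the minimal polynomial of \<open>w\<close> is x (x - T)
  modulo \<open>l\<close>, with distinct roots. So \<open>l\<close> splits, and \<open>w\<close>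
  lies in exactly one of the two conjugate primes above it. The congruence puts \<open>V\<close>
  into the same prime and outside the other, whereas a real element lies in both or in neither. Why
  2 p + q: since 1 + h^2 is proportional to (p / q)^2, the norm of \<open>w\<close> is (2 p - q) (2
  p + q) up to a factor 1 or 3. Modulo 2 p + q the number \<open>V\<close> is a multiple of
  \<open>w\<close>; modulo 2 p - q it is a multiple of the conjugate of \<open>w\<close>, and the
  two contributions might cancel. The obstacle is the prime 2 and, for n = 6, the prime 3: they
  divide the trace. There \<open>w\<close> and \<open>V\<close> have to be divided by an integer
  first, and a factor 2 or 3 of 2 p + q survives this if 8 or 9 divides it. Of the finitely many
  remaining values of 2 p + q, size and parity exclude all but one.\<close>

inductive_set cyclo_int :: "complex \<Rightarrow> complex set" for \<zeta> :: complex where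
  one: "1 \<in> cyclo_int \<zeta>"
| diff: "x \<in> cyclo_int \<zeta> \<Longrightarrow> y \<in> cyclo_int \<zeta> \<Longrightarrow> x - y \<in> cyclo_int \<zeta>"
| root: "x \<in> cyclo_int \<zeta> \<Longrightarrow> \<zeta> * x \<in> cyclo_int \<zeta>"

lemma cyclo_int_zero: "0 \<in> cyclo_int \<zeta>"
  using cyclo_int.diff[OF cyclo_int.one cyclo_int.one] by simp

lemma cyclo_int_uminus: "x \<in> cyclo_int \<zeta> \<Longrightarrow> - x \<in> cyclo_int \<zeta>"
  using cyclo_int.diff[OF cyclo_int_zero, of x] by simp

lemma cyclo_int_add: "x \<in> cyclo_int \<zeta> \<Longrightarrow> y \<in> cyclo_int \<zeta> \<Longrightarrow> x + y \<in> cyclo_int \<zeta>"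
  using cyclo_int.diff[OF _ cyclo_int_uminus, of x \<zeta> y] by simp

lemma cyclo_int_mult:
  assumes "x \<in> cyclo_int \<zeta>" "y \<in> cyclo_int \<zeta>"
  shows "x * y \<in> cyclo_int \<zeta>"
  using assms
  by (induction x) (simp_all add: left_diff_distrib mult.assoc cyclo_int.diff cyclo_int.root)

lemma cyclo_int_power: "x \<in> cyclo_int \<zeta> \<Longrightarrow> x ^ k \<in> cyclo_int \<zeta>"
  by (induction k) (auto intro: cyclo_int.one cyclo_int_mult)

lemma cyclo_int_of_nat: "of_nat k \<in> cyclo_int \<zeta>"
  by (induction k) (auto intro: cyclo_int.one cyclo_int_zero cyclo_int_add)

lemma cyclo_int_of_int: "of_int k \<in> cyclo_int \<zeta>"
  by (cases k rule: int_cases2) (auto intro: cyclo_int_uminus cyclo_int_of_nat)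

lemma cyclo_int_self: "\<zeta> \<in> cyclo_int \<zeta>"
  using cyclo_int.root[OF cyclo_int.one, of \<zeta>] by simp

lemma cyclo_int_sum: "(\<And>i. i \<in> A \<Longrightarrow> f i \<in> cyclo_int \<zeta>) \<Longrightarrow> sum f A \<in> cyclo_int \<zeta>"
  by (induction A rule: infinite_finite_induct) (auto intro: cyclo_int_zero cyclo_int_add)

text \<open>The powers \<open>\<zeta> ^ j\<close> with \<open>j < N\<close> span the ring, so each
  element acts on them by an integer matrix. The powers may be linearly dependent; the matrix is not
  unique and only its existence matters.\<close>

lemma cyclo_int_matrix:
  assumes "x \<in> cyclo_int \<zeta>" "\<zeta> ^ N = 1" "N > 0"
  shows "\<exists>a :: nat \<Rightarrow> nat \<Rightarrow> int. \<forall>i<N. x * \<zeta> ^ i = (\<Sum>j<N. of_int (a i j) * \<zeta> ^ j)"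
  using assms(1)
proof induction
  case one
  have "of_int (if i = j then 1 else 0) * \<zeta> ^ j = (if i = j then \<zeta> ^ j else 0)" for i j
    by simp
  then show ?case
    by (intro exI[of _ "\<lambda>i j. if i = j then 1 else 0"]) (simp add: sum.delta)
next
  case (diff x y)
  then obtain a b :: "nat \<Rightarrow> nat \<Rightarrow> int" where
    "\<forall>i<N. x * \<zeta> ^ i = (\<Sum>j<N. of_int (a i j) * \<zeta> ^ j)"
    "\<forall>i<N. y * \<zeta> ^ i = (\<Sum>j<N. of_int (b i j) * \<zeta> ^ j)" by blast
  then show ?case
    by (intro exI[of _ "\<lambda>i j. a i j - b i j"]) (simp add: algebra_simps sum_subtractf)
next
  case (root x)
  then obtain a :: "nat \<Rightarrow> nat \<Rightarrow> int" where
    a: "\<forall>i<N. x * \<zeta> ^ i = (\<Sum>j<N. of_int (a i j) * \<zeta> ^ j)" by blast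
  \<comment> \<open>Multiplying by \<zeta> replaces row \<open>i\<close> by row
    \<open>Suc i\<close>, wrapping around at \<open>N\<close> because
    \<open>\<zeta> ^ N = 1\<close>.\<close>
  have "\<zeta> * x * \<zeta> ^ i = (\<Sum>j<N. of_int (a (Suc i mod N) j) * \<zeta> ^ j)" if "i < N" for i
  proof -
    have "\<zeta> ^ (Suc i mod N) = \<zeta> ^ Suc i"
    proof -
      have "\<zeta> ^ Suc i = \<zeta> ^ (N * (Suc i div N) + Suc i mod N)" by simp
      also have "\<dots> = \<zeta> ^ (Suc i mod N)"
        by (simp only: power_add power_mult assms(2) power_one mult_1)
      finally show ?thesis by simp
    qed
    then have "\<zeta> * x * \<zeta> ^ i = x * \<zeta> ^ (Suc i mod N)" by (simp add: mult_ac)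
    then show ?thesis using a assms(3) by simp
  qed
  then show ?case by (intro exI[of _ "\<lambda>i j. a (Suc i mod N) j"]) simp
qed

section \<open>The localisation of the integers at 2\<close>

definition odd_frac :: "complex set" where
  "odd_frac = {x. \<exists>m n :: int. odd n \<and> x = of_int m / of_int n}"

lemma odd_frac_of_int: "of_int k \<in> odd_frac"
  unfolding odd_frac_def by (intro CollectI exI[of _ k] exI[of _ 1]) auto

lemma odd_frac_add: "x \<in> odd_frac \<Longrightarrow> y \<in> odd_frac \<Longrightarrow> x + y \<in> odd_frac"
  unfolding odd_frac_def
proof safe
  fix m n m' n' :: int assume "odd n" "odd n'"
  then have "n \<noteq> 0" "n' \<noteq> 0" by auto
  then have "of_int m / of_int n + of_int m' / (of_int n' :: complex)
      = of_int (m * n' + m' * n) / of_int (n * n')"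
    by (simp add: field_simps)
  then show "\<exists>m'' n''. odd n'' \<and> of_int m / of_int n + of_int m' / (of_int n' :: complex)
      = of_int m'' / of_int n''"
    using \<open>odd n\<close> \<open>odd n'\<close> by (intro exI[of _ "m * n' + m' * n"] exI[of _ "n * n'"]) simp
qed

lemma odd_frac_mult: "x \<in> odd_frac \<Longrightarrow> y \<in> odd_frac \<Longrightarrow> x * y \<in> odd_frac"
  unfolding odd_frac_def
proof safe
  fix m n m' n' :: int assume "odd n" "odd n'"
  have "of_int m / of_int n * (of_int m' / (of_int n' :: complex))
      = of_int (m * m') / of_int (n * n')" by simp
  then show "\<exists>m'' n''. odd n'' \<and> of_int m / of_int n * (of_int m' / (of_int n' :: complex))
      = of_int m'' / of_int n''"
    using \<open>odd n\<close> \<open>odd n'\<close> by (intro exI[of _ "m * m'"] exI[of _ "n * n'"]) simp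
qed

text \<open>The numerator \<open>n - 2 * m\<close> stays odd, so elements congruent to 1 modulo 2
  are units. They serve as pivots in the elimination below.\<close>

lemma odd_frac_inverse:
  assumes "x \<in> odd_frac"
  shows "1 - 2 * x \<noteq> 0" "1 / (1 - 2 * x) \<in> odd_frac"
proof -
  obtain m n :: int where mn: "odd n" "x = of_int m / of_int n"
    using assms by (auto simp: odd_frac_def)
  then have "n \<noteq> 0" by auto
  have "n - 2 * m \<noteq> 0" using mn(1) by presburger
  then have nz: "of_int (n - 2 * m) \<noteq> (0::complex)" by (simp only: of_int_eq_0_iff not_False_eq_True)
  have eq: "1 - 2 * x = of_int (n - 2 * m) / of_int n"
    using mn \<open>n \<noteq> 0\<close> by (simp add: field_simps)
  show "1 - 2 * x \<noteq> 0" unfolding eq using nz \<open>n \<noteq> 0\<close> by (simp del: of_int_diff of_int_mult)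
  show "1 / (1 - 2 * x) \<in> odd_frac"
    unfolding odd_frac_def
    by (intro CollectI exI[of _ n] exI[of _ "n - 2 * m"])
      (unfold eq, use mn(1) in \<open>simp del: of_int_diff of_int_mult\<close>)
qed

text \<open>Nakayama's lemma for the localisation of the integers at 2, by elimination.\<close>

lemma nakayama_two:
  fixes x :: "nat \<Rightarrow> complex" and a :: "nat \<Rightarrow> nat \<Rightarrow> complex"
  assumes "\<And>i. i < d \<Longrightarrow> x i = 2 * (\<Sum>j<d. a i j * x j)"
    and "\<And>i j. i < d \<Longrightarrow> j < d \<Longrightarrow> a i j \<in> odd_frac"
  shows "\<forall>i<d. x i = 0"
  using assms
proof (induction d arbitrary: a)
  case 0
  then show ?case by simp
next
  case (Suc d)
  define u where "u = 1 / (1 - 2 * a d d)"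
  have u: "u \<in> odd_frac" "1 - 2 * a d d \<noteq> 0"
    unfolding u_def using odd_frac_inverse Suc.prems(2)[of d d] by auto
  have "x d = 2 * (\<Sum>j<d. a d j * x j) + 2 * a d d * x d"
    using Suc.prems(1)[of d] by (simp add: algebra_simps)
  then have "(1 - 2 * a d d) * x d = 2 * (\<Sum>j<d. a d j * x j)"
    by (simp add: algebra_simps)
  then have xd: "x d = u * (2 * (\<Sum>j<d. a d j * x j))"
    using u(2) by (simp add: u_def nonzero_eq_divide_eq mult.commute)
  define b where "b i j = a i j + of_int 2 * a i d * u * a d j" for i j
  have "x i = 2 * (\<Sum>j<d. b i j * x j)" if "i < d" for i
  proof -
    have "x i = 2 * ((\<Sum>j<d. a i j * x j) + a i d * x d)"
      using Suc.prems(1)[of i] that by simp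
    also have "a i d * x d = (\<Sum>j<d. of_int 2 * a i d * u * a d j * x j)"
      unfolding xd by (simp add: sum_distrib_left mult_ac)
    finally show ?thesis by (simp add: b_def sum.distrib algebra_simps)
  qed
  moreover have "b i j \<in> odd_frac" if "i < d" "j < d" for i j
    unfolding b_def by (intro odd_frac_add odd_frac_mult odd_frac_of_int u Suc.prems(2))
      (use that in auto)
  ultimately have "\<forall>i<d. x i = 0" by (rule Suc.IH)
  then show ?case using xd by (auto simp: less_Suc_eq)
qed

text \<open>If 1/2 were in the ring, halving would map the module spanned by the powers of \<zeta>
  into itself, so the module would be twice itself. Nakayama then kills every generator, among them
  \<open>\<zeta> ^ 0 = 1\<close>.\<close>

lemma half_notin_cyclo_int:
  assumes "\<zeta> ^ N = 1" "N > 0"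
  shows "1 / 2 \<notin> cyclo_int \<zeta>"
proof
  assume "1 / 2 \<in> cyclo_int \<zeta>"
  then obtain a :: "nat \<Rightarrow> nat \<Rightarrow> int" where
    a: "\<forall>i<N. 1 / 2 * \<zeta> ^ i = (\<Sum>j<N. of_int (a i j) * \<zeta> ^ j)"
    using cyclo_int_matrix assms by blast
  have "\<zeta> ^ i = 2 * (\<Sum>j<N. of_int (a i j) * \<zeta> ^ j)" if "i < N" for i
    using a that by (simp add: field_simps)
  then have "\<forall>i<N. \<zeta> ^ i = 0"
    by (rule nakayama_two[where a = "\<lambda>i j. of_int (a i j)"]) (auto simp: odd_frac_of_int)
  then have "\<zeta> ^ 0 = 0" using assms(2) by blast
  then show False by simp
qed

text \<open>All powers of \<eta> are 1 modulo 2. A power \<mu> other than 1 with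
  \<open>\<mu> ^ o' = 1\<close>, \<open>o'\<close> odd, would make a geometric sum vanish that is
  congruent to \<open>o'\<close>; a power whose square is -1 would give
  \<open>\<delta> - \<delta> * \<delta> = 1 / 2\<close>. Both put 1/2 into the ring, so the order of
  \<eta> is a power of two not divisible by 4.\<close>

lemma root_of_unity_cong_one_mod_two:
  assumes \<zeta>: "\<zeta> ^ N = 1" "N > 0"
    and \<eta>: "\<eta> ^ K = 1" "K > 0" "\<eta> = 1 - 2 * \<gamma>" "\<gamma> \<in> cyclo_int \<zeta>"
  shows "\<eta>\<^sup>2 = 1"
proof -
  have \<eta>in: "\<eta> \<in> cyclo_int \<zeta>"
    using cyclo_int.diff[OF cyclo_int.one cyclo_int_mult[OF cyclo_int_of_nat[of 2] \<eta>(4)]] \<eta>(3)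
    by simp
  have cong: "\<exists>\<delta>\<in>cyclo_int \<zeta>. \<eta> ^ k = 1 - 2 * \<delta>" for k
  proof (induction k)
    case 0
    then show ?case using cyclo_int_zero by fastforce
  next
    case (Suc k)
    then obtain \<delta> where \<delta>: "\<delta> \<in> cyclo_int \<zeta>" "\<eta> ^ k = 1 - 2 * \<delta>" by blast
    have "\<gamma> + \<eta> * \<delta> \<in> cyclo_int \<zeta>"
      by (intro cyclo_int_add cyclo_int_mult \<eta> \<delta> \<eta>in)
    moreover have "\<eta> ^ Suc k = \<eta> - 2 * (\<eta> * \<delta>)"
      using \<delta>(2) by (simp add: right_diff_distrib)
    then have "\<eta> ^ Suc k = 1 - 2 * (\<gamma> + \<eta> * \<delta>)"
      using \<eta>(3) by (metis diff_diff_eq distrib_left)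
    ultimately show ?case by blast
  qed
  obtain s o' where K: "K = 2 ^ s * o'" "odd o'"
    using \<eta>(2) multiplicity_decompose'[of K 2] by (metis neq0_conv odd_one)
  have "\<eta> ^ 2 ^ s = 1"
  proof (rule ccontr)
    define \<mu> where "\<mu> = \<eta> ^ 2 ^ s"
    assume "\<eta> ^ 2 ^ s \<noteq> 1"
    then have "\<mu> \<noteq> 1" "\<mu> ^ o' = 1" using K \<eta>(1) by (auto simp: \<mu>_def power_mult)
    then have "(\<Sum>i<o'. \<mu> ^ i) = 0" by (simp add: geometric_sum)
    moreover have "\<forall>i. \<exists>\<delta>\<in>cyclo_int \<zeta>. \<mu> ^ i = 1 - 2 * \<delta>"
      using cong by (auto simp: \<mu>_def power_mult[symmetric])
    then obtain \<delta> where \<delta>: "\<And>i. \<delta> i \<in> cyclo_int \<zeta>" "\<And>i. \<mu> ^ i = 1 - 2 * \<delta> i" by metis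
    ultimately have "of_nat o' - 2 * (\<Sum>i<o'. \<delta> i) = 0"
      by (simp add: sum_subtractf sum_distrib_left)
    moreover obtain k where "o' = 2 * k + 1" using K(2) by (auto elim: oddE)
    ultimately have "1 / 2 = (\<Sum>i<o'. \<delta> i) - of_nat k" by (simp add: field_simps)
    also have "\<dots> \<in> cyclo_int \<zeta>"
      by (intro cyclo_int.diff cyclo_int_sum \<delta> cyclo_int_of_nat)
    finally show False using half_notin_cyclo_int[OF \<zeta>] by simp
  qed
  then show ?thesis
  proof (induction s)
    case 0
    then show ?case by simp
  next
    case (Suc s)
    show ?case
    proof (cases "s = 0")
      case True
      then show ?thesis using Suc.prems by simp
    next
      case False
      define \<mu> where "\<mu> = \<eta> ^ 2 ^ (s - 1)"
      have s: "2 ^ s = 2 ^ (s - 1) * (2::nat)" "2 ^ Suc s = 2 ^ (s - 1) * (4::nat)"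
        using False by (cases s; simp)+
      have \<mu>2: "\<eta> ^ 2 ^ s = \<mu>\<^sup>2" by (simp add: \<mu>_def s(1) power_mult)
      have "\<mu> ^ 4 = 1" using Suc.prems by (simp only: \<mu>_def s(2) power_mult)
      then have "(\<mu>\<^sup>2 - 1) * (\<mu>\<^sup>2 + 1) = 0" by (simp add: algebra_simps power2_eq_square power4_eq_xxxx)
      moreover have "\<mu>\<^sup>2 + 1 \<noteq> 0"
      proof
        assume *: "\<mu>\<^sup>2 + 1 = 0"
        obtain \<delta> where \<delta>: "\<delta> \<in> cyclo_int \<zeta>" "\<mu> = 1 - 2 * \<delta>" using cong \<mu>_def by blast
        have "\<delta> - \<delta> * \<delta> \<in> cyclo_int \<zeta>" by (intro cyclo_int.diff cyclo_int_mult \<delta>)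
        moreover have "4 * (\<delta> - \<delta> * \<delta>) = 4 * (1 / 2)"
          using * by (simp add: \<delta>(2) power2_eq_square algebra_simps)
        then have "\<delta> - \<delta> * \<delta> = 1 / 2" by (simp only: mult_left_cancel zero_neq_numeral[symmetric] not_False_eq_True)
        ultimately show False using half_notin_cyclo_int[OF \<zeta>] by simp
      qed
      ultimately show ?thesis using \<mu>2 Suc.IH by simp
    qed
  qed
qed

text \<open>The hypothesis says that \<open>2 cos (2 \<alpha>)\<close> is twice a cyclotomic integer,
  so \<open>- exp (4 i \<alpha>)\<close> is a root of unity congruent to 1 modulo 2.\<close>

lemma rational_angle_quarter:
  fixes u v w :: int
  assumes "x \<in> \<rat>" "\<alpha> = x * pi" "y \<in> \<rat>" "\<beta> = y * pi" "0 < \<alpha>" "\<alpha> < pi / 2"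
    and rel: "cos (2 * \<alpha>) = of_int u + of_int v * (2 * cos \<beta>) + of_int w * (2 * cos (2 * \<alpha>))"
  shows "\<alpha> = pi / 4" "2 * cos \<beta> \<noteq> of_int k + 1 / 2"
proof -
  obtain a b :: int where a: "b > 0" "x = of_int a / of_int b"
    using assms(1) by (metis Rats_cases')
  obtain c d :: int where c: "d > 0" "y = of_int c / of_int d"
    using assms(3) by (metis Rats_cases')
  define N where "N = nat (b * d)"
  have N: "N > 0" "real N = of_int b * of_int d" using a c by (auto simp: N_def)
  \<comment> \<open>\<open>N\<close> is a common denominator of both angles over pi, so \<zeta>
    generates all exponentials involved. Cosines have to be doubled to become sums of two such
    exponentials.\<close>
  define \<zeta> where "\<zeta> = cis (pi / N)"
  have \<zeta>: "\<zeta> ^ (2 * N) = 1" "2 * N > 0"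
    using N by (simp_all add: \<zeta>_def Complex.DeMoivre)
  have cis_in: "cis (of_int m * (pi / N)) \<in> cyclo_int \<zeta>" for m :: int
  proof -
    have eq: "real_of_int (m mod (2 * N)) = of_int m - 2 * N * of_int (m div (2 * N))"
      unfolding minus_mult_div_eq_mod[symmetric] by simp
    have "\<zeta> ^ nat (m mod (2 * N)) = cis (of_int (m mod (2 * N)) * (pi / N))"
      using N by (simp add: \<zeta>_def Complex.DeMoivre)
    also have "\<dots> = cis (of_int m * (pi / N) - 2 * pi * of_int (m div (2 * N)))"
      unfolding eq using N(1) by (intro arg_cong[of _ _ cis]) (simp add: field_simps)
    also have "\<dots> = cis (of_int m * (pi / N))"
      by (simp add: cis_divide[symmetric] cis_multiple_2pi)
    finally show ?thesis using cyclo_int_power[OF cyclo_int_self] by metis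
  qed
  have cos_in: "complex_of_real (2 * cos (of_int m * (pi / N))) \<in> cyclo_int \<zeta>" for m :: int
  proof -
    have "complex_of_real (2 * cos (of_int m * (pi / N)))
        = cis (of_int m * (pi / N)) + cis (of_int (- m) * (pi / N))"
      by (simp add: complex_eq_iff)
    then show ?thesis using cis_in cyclo_int_add by metis
  qed
  have \<alpha>N: "\<alpha> = of_int (a * d) * (pi / N)" using assms(2) a(1) c(1) by (simp add: N(2) a(2) field_simps)
  have \<beta>N: "\<beta> = of_int (c * b) * (pi / N)" using assms(4) a(1) c(1) by (simp add: N(2) c(2) field_simps)
  have \<alpha>2N: "2 * \<alpha> = of_int (2 * a * d) * (pi / N)" by (simp add: \<alpha>N)
  show "2 * cos \<beta> \<noteq> of_int k + 1 / 2"
  proof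
    assume "2 * cos \<beta> = of_int k + 1 / 2"
    then have "complex_of_real (2 * cos \<beta>) - of_int k = 1 / 2" by (simp add: complex_eq_iff)
    moreover have "complex_of_real (2 * cos \<beta>) - of_int k \<in> cyclo_int \<zeta>"
      unfolding \<beta>N by (intro cyclo_int.diff cyclo_int_of_int cos_in)
    ultimately have "1 / 2 \<in> cyclo_int \<zeta>" by (simp only:)
    then show False using half_notin_cyclo_int[OF \<zeta>] by blast
  qed
  define g where "g = of_int u + of_int v * complex_of_real (2 * cos \<beta>)
      + of_int w * complex_of_real (2 * cos (2 * \<alpha>))"
  have g: "g \<in> cyclo_int \<zeta>" "g = complex_of_real (cos (2 * \<alpha>))"
  proof -
    show "g \<in> cyclo_int \<zeta>"
      unfolding g_def \<alpha>2N \<beta>N by (intro cyclo_int_add cyclo_int_mult cyclo_int_of_int cos_in)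
    show "g = complex_of_real (cos (2 * \<alpha>))"
      by (subst rel) (simp add: g_def)
  qed
  define \<eta> where "\<eta> = - cis (4 * \<alpha>)"
  have "\<eta>\<^sup>2 = 1"
  proof (rule root_of_unity_cong_one_mod_two[OF \<zeta>])
    show "cis (2 * \<alpha>) * g \<in> cyclo_int \<zeta>"
      using cis_in[of "2 * a * d"] g(1) \<alpha>2N cyclo_int_mult by metis
    \<comment> \<open>Taking out cis (2 \<alpha>) leaves 2 cos (2 \<alpha>) = 2 \<open>g\<close>,
      which exhibits the factor 2 in 1 - \<eta>.\<close>
    have "cis (2 * \<alpha>) * (cis (2 * \<alpha>) + cis (- (2 * \<alpha>))) = cis (4 * \<alpha>) + 1"
      by (simp add: distrib_left cis_mult)
    moreover have "cis (2 * \<alpha>) + cis (- (2 * \<alpha>)) = 2 * g"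
      unfolding g(2) by (simp add: complex_eq_iff)
    ultimately have "cis (2 * \<alpha>) * (2 * g) = cis (4 * \<alpha>) + 1" by simp
    then show "\<eta> = 1 - 2 * (cis (2 * \<alpha>) * g)" by (simp add: \<eta>_def mult_ac)
    have "\<eta> ^ (2 * N) = cis (4 * \<alpha>) ^ (2 * N)"
      by (simp add: \<eta>_def)
    also have "\<dots> = cis (4 * \<alpha> * (2 * N))" by (simp only: Complex.DeMoivre mult.commute)
    also have "4 * \<alpha> * (2 * N) = 2 * pi * of_int (4 * a * d)" using N(1) by (simp add: \<alpha>N)
    also have "cis \<dots> = 1" by (rule cis_multiple_2pi) (rule Ints_of_int)
    finally show "\<eta> ^ (2 * N) = 1" .
  qed (use N in simp)
  then have "cis (8 * \<alpha>) = 1" by (simp add: \<eta>_def power2_eq_square cis_mult)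
  then have "cos (8 * \<alpha>) = 1" by (simp add: complex_eq_iff)
  then obtain m :: int where m: "8 * \<alpha> = of_int m * 2 * pi"
    using cos_one_2pi_int by auto
  then have "of_int m * pi = 4 * \<alpha>" by simp
  moreover have "0 < of_int m * pi" using calculation assms(5) by simp
  then have "0 < m" by (simp add: zero_less_mult_iff)
  moreover have "m < 2"
  proof -
    have "of_int m * pi < 2 * pi" using calculation(1) assms(6) by simp
    then show ?thesis by simp
  qed
  ultimately have "m = 1" "of_int m * pi = 4 * \<alpha>" by auto
  then show "\<alpha> = pi / 4" by simp
qed

section \<open>Power products that are never real\<close>

definition nonreal_combinations :: "complex \<Rightarrow> int \<Rightarrow> complex set" where
  "nonreal_combinations w l = {of_int x + of_int y * w | x y. l dvd x \<and> \<not> l dvd y}"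

lemma nonreal_combinationsI:
  "l dvd x \<Longrightarrow> \<not> l dvd y \<Longrightarrow> V = of_int x + of_int y * w \<Longrightarrow> V \<in> nonreal_combinations w l"
  by (auto simp: nonreal_combinations_def)

text \<open>Modulo \<open>l\<close> the quadratic equation reads w^2 = T w with \<open>T\<close>
  invertible, so the product of y w and y' w is the multiple y y' T w, again nonzero.\<close>

lemma nonreal_combinations_mult:
  fixes l T M :: int
  assumes "prime l" "l dvd M" "\<not> l dvd T" "w\<^sup>2 = of_int T * w - of_int M"
    and "U \<in> nonreal_combinations w l" "V \<in> nonreal_combinations w l"
  shows "U * V \<in> nonreal_combinations w l"
proof -
  obtain x y x' y' where xy: "l dvd x" "\<not> l dvd y" "U = of_int x + of_int y * w"
      "l dvd x'" "\<not> l dvd y'" "V = of_int x' + of_int y' * w"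
    using assms(5,6) by (auto simp: nonreal_combinations_def)
  have "U * V = of_int x * of_int x' + (of_int x * of_int y' + of_int x' * of_int y) * w
      + of_int y * of_int y' * w\<^sup>2"
    by (simp add: xy power2_eq_square algebra_simps)
  also have "\<dots> = of_int (x * x' - y * y' * M) + of_int (x * y' + x' * y + y * y' * T) * w"
    unfolding assms(4) by (simp add: algebra_simps)
  finally have eq: "U * V = of_int (x * x' - y * y' * M) + of_int (x * y' + x' * y + y * y' * T) * w" .
  have "\<not> l dvd y * y' * T" using xy assms by (simp add: prime_dvd_mult_iff)
  moreover have "l dvd x * y' + x' * y" using xy by simp
  ultimately have "\<not> l dvd x * y' + x' * y + y * y' * T" by (simp add: dvd_add_right_iff)
  moreover have "l dvd x * x' - y * y' * M" using xy assms by simp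
  ultimately show ?thesis using eq by (intro nonreal_combinationsI)
qed

lemma nonreal_combinations_power_product:
  fixes l T M :: int
  assumes l: "prime l" "l dvd M" "\<not> l dvd T" "w\<^sup>2 = of_int T * w - of_int M"
    and V: "V \<in> nonreal_combinations w l" and "A > 0"
  shows "w ^ A * V ^ B \<in> nonreal_combinations w l"
proof -
  have w: "w \<in> nonreal_combinations w l"
    by (rule nonreal_combinationsI[of _ 0 1]) (use l in auto)
  \<comment> \<open>The exponent of \<open>w\<close> has to start at 1, since 1 need not be a
    member; the powers of \<open>V\<close> only multiply a member and may be absent.\<close>
  have "w ^ Suc k \<in> nonreal_combinations w l" for k
    by (induction k) (use w nonreal_combinations_mult[OF l] in auto)
  then have "w ^ A \<in> nonreal_combinations w l" using \<open>A > 0\<close> by (metis Suc_pred)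
  then show ?thesis
    by (induction B) (use V nonreal_combinations_mult[OF l] in \<open>auto simp: mult.left_commute\<close>)
qed

lemma nonreal_combinations_not_real:
  assumes "Im w \<noteq> 0" "V \<in> nonreal_combinations w l"
  shows "Im V \<noteq> 0"
  using assms by (auto simp: nonreal_combinations_def)

lemma angles_not_rational:
  fixes l T M :: int and p q :: nat and r s \<alpha> \<beta> z :: real
  assumes l: "prime l" "l dvd M" "\<not> l dvd T" "w\<^sup>2 = of_int T * w - of_int M" "Im w \<noteq> 0"
    and V: "V \<in> nonreal_combinations w l"
    and pq: "q > 0"
    and \<alpha>: "w = of_real r * cis \<alpha>" and \<beta>: "V = of_real s * cis \<beta>"
    and z: "z \<in> \<rat>"
  shows "q * \<alpha> + p * \<beta> \<noteq> z * pi"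
proof
  assume eq: "q * \<alpha> + p * \<beta> = z * pi"
  obtain a b :: int where ab: "b > 0" "z = of_int a / of_int b"
    using z by (metis Rats_cases')
  \<comment> \<open>Raising to the denominator of \<open>z\<close> turns the angle relation into a
    power product whose argument is an integer multiple of pi.\<close>
  define m where "m = nat b"
  have m: "m > 0" "real m * z = of_int a" using ab by (auto simp: m_def)
  have "w ^ (m * q) * V ^ (m * p)
      = of_real (r ^ (m * q) * s ^ (m * p)) * cis (m * (q * \<alpha> + p * \<beta>))"
    by (simp add: \<alpha> \<beta> power_mult_distrib Complex.DeMoivre cis_mult algebra_simps)
  also have "m * (q * \<alpha> + p * \<beta>) = of_int a * pi" unfolding eq m(2)[symmetric] by simp
  finally have "Im (w ^ (m * q) * V ^ (m * p)) = 0"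
    by (simp add: sin_times_pi_eq_0 mult.commute flip: of_real_power of_real_mult)
  then show False
    using nonreal_combinations_not_real[OF l(5) nonreal_combinations_power_product[OF l(1-4) V, of "m * q" "m * p"]]
      m pq by simp
qed

text \<open>Prime factors are stripped one at a time: without a prime above 3 and without 8 or 9 as
  divisors, \<open>g\<close> divides 12. The powers 8 and 9 are those that leave a factor 2 or 3 of
  2 p + q once \<open>w\<close> and \<open>V\<close> have been rescaled.\<close>

lemma prime_factor_cases:
  fixes g :: nat
  assumes "g > 0"
  obtains l where "prime l" "l dvd g" "l > 3" | "9 dvd g" | "8 dvd g" | "g \<in> {1, 2, 4, 3, 6, 12}"
proof -
  have "(\<exists>l. prime l \<and> l dvd g \<and> l > 3) \<or> 9 dvd g \<or> 8 dvd g \<or> g \<in> {1, 2, 4, 3, 6, 12}"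
    using assms
  proof (induction g rule: less_induct)
    case (less g)
    show ?case
    proof (cases "g = 1")
      case False
      then obtain l where l: "prime l" "l dvd g" using prime_factor_nat by blast
      then obtain k where k: "g = l * k" by (auto elim: dvdE)
      have "k > 0" "k < g" using k less.prems l(1) prime_gt_1_nat[of l] by auto
      then have IH: "(\<exists>l. prime l \<and> l dvd k \<and> l > 3) \<or> 9 dvd k \<or> 8 dvd k \<or> k \<in> {1, 2, 4, 3, 6, 12}"
        using less.IH by blast
      show ?thesis
      proof (cases "l > 3")
        case True
        then show ?thesis using l by blast
      next
        case False
        then have "l = 2 \<or> l = 3" using prime_ge_2_nat[OF l(1)] by auto
        with IH show ?thesis
        proof (elim disjE)
          assume "\<exists>l. prime l \<and> l dvd k \<and> l > 3"
          then show ?thesis unfolding k by (meson dvd_mult)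
        qed (auto simp: k)
      qed
    qed simp
  qed
  then show ?thesis using that by (elim disjE exE conjE)
qed

text \<open>The version for n = 3 and n = 4, where the trace of \<open>w\<close> is 2 q and the
  prime 3 is as good as any other odd prime.\<close>

lemma odd_prime_factor_cases:
  fixes g :: nat
  assumes "g > 0"
  obtains l where "prime l" "l dvd g" "l > 2" | "8 dvd g" | "g \<in> {1, 2, 4}"
proof (rule prime_factor_cases[OF assms])
  assume "9 dvd g"
  then have "3 dvd g" by presburger
  then show thesis using that(1)[of 3] by simp
next
  assume "g \<in> {1, 2, 4, 3, 6, 12}"
  then have "g \<in> {1, 2, 4} \<or> 3 dvd g" by auto
  then show thesis using that(1)[of 3] that(3) by auto
next
  fix l :: nat
  assume "prime l" "l dvd g" "l > 3"
  then show thesis using that(1)[of l] by simp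
next
  assume "8 dvd g"
  then show thesis by (rule that(2))
qed

lemma eight_dvd_double_add:
  fixes p q :: nat
  assumes "8 dvd 2 * p + q" "coprime p q"
  obtains q' where "q = 2 * q'" "odd p" "odd q'" "4 dvd p + q'"
proof -
  have "even q" using assms(1) by presburger
  then obtain q' where q': "q = 2 * q'" by (auto elim: evenE)
  have "odd p" using assms(2) q' by auto
  moreover have "4 dvd p + q'" using assms(1) q' by presburger
  moreover from this have "odd q'" using \<open>odd p\<close> by presburger
  ultimately show ?thesis using that q' by blast
qed

text \<open>Modulo \<open>l\<close> one has q = - 2 p with 2 invertible, so \<open>l\<close> divides
  both or neither of \<open>p\<close> and \<open>q\<close>. This keeps the trace of \<open>w\<close>
  and the coefficient of \<open>w\<close> in \<open>V\<close> prime to \<open>l\<close>.\<close>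

lemma prime_dvd_double_add:
  fixes p q l :: nat
  assumes "prime l" "l dvd 2 * p + q" "coprime p q" "l > 2"
  shows "\<not> int l dvd int p" "\<not> int l dvd int q" "\<not> int l dvd 2" "int l dvd 2 * int p + int q"
proof -
  have "\<not> l dvd 2" using assms(4) by (auto dest: dvd_imp_le)
  have "\<not> (l dvd p \<and> l dvd q)" using assms(1,3) by (auto dest: coprime_common_divisor)
  moreover have "l dvd p \<longleftrightarrow> l dvd q"
    using assms(1,2) \<open>\<not> l dvd 2\<close>
    using dvd_add_right_iff[of l "2 * p" q] dvd_add_left_iff[of l q "2 * p"] prime_dvd_mult_iff[of l 2 p]
    by blast
  ultimately show "\<not> int l dvd int p" "\<not> int l dvd int q" by auto
  show "\<not> int l dvd 2" using \<open>\<not> l dvd 2\<close> using int_dvd_int_iff[of l 2] by simp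
  show "int l dvd 2 * int p + int q" using assms(2) int_dvd_int_iff[of l "2 * p + q"] by simp
qed

text \<open>The criterion in real coordinates: w = a + b i has trace 2 a and norm a^2 + b^2, its
  argument \<alpha> is read off from the tangent; V = c + d i = x + y w has absolute value
  \<open>N\<close>. The cosine fixes \<beta> only up to sign, and \<open>d \<ge> 0\<close> matches
  the choice of \<beta> in [0, pi].\<close>

lemma angles_not_rational_real:
  fixes l T M x y :: int and p q :: nat and a b c d N \<alpha> \<beta> z :: real
  assumes l: "prime l" "l dvd M" "\<not> l dvd T" "of_int T = 2 * a" "of_int M = a\<^sup>2 + b\<^sup>2" "b > 0"
    and V: "l dvd x" "\<not> l dvd y" "c = of_int x + of_int y * a" "d = of_int y * b"
    and "q > 0"
    and \<alpha>: "0 < \<alpha>" "\<alpha> < pi / 2" "a * tan \<alpha> = b"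
    and \<beta>: "0 \<le> \<beta>" "\<beta> \<le> pi" "cos \<beta> = c / N" "c\<^sup>2 + d\<^sup>2 = N\<^sup>2" "N > 0" "d \<ge> 0"
    and "z \<in> \<rat>"
  shows "q * \<alpha> + p * \<beta> \<noteq> z * pi"
proof (rule angles_not_rational[OF l(1-3)])
  define w where "w = Complex a b"
  show "w\<^sup>2 = of_int T * w - of_int M" "Im w \<noteq> 0"
    using l(6) by (simp_all add: w_def complex_eq_iff l(4,5) power2_eq_square)
  show "Complex c d \<in> nonreal_combinations w l"
    by (rule nonreal_combinationsI[OF V(1,2)]) (simp add: w_def complex_eq_iff V(3,4))
  have "cos \<alpha> > 0" using \<alpha> by (intro cos_gt_zero_pi) auto
  then show "w = of_real (a / cos \<alpha>) * cis \<alpha>"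
    using \<alpha>(3) by (simp add: w_def complex_eq_iff tan_def)
  have "(N * sin \<beta>)\<^sup>2 = N\<^sup>2 - (N * cos \<beta>)\<^sup>2"
    by (simp add: power_mult_distrib sin_squared_eq right_diff_distrib)
  also have "N * cos \<beta> = c" using \<beta>(3,5) by simp
  also have "N\<^sup>2 - c\<^sup>2 = d\<^sup>2" using \<beta>(4) by simp
  finally have "N * sin \<beta> = d"
    using \<beta>(5,6) sin_ge_zero[OF \<beta>(1,2)] by (simp add: power2_eq_iff_nonneg)
  then show "Complex c d = of_real N * cis \<beta>"
    using \<open>N * cos \<beta> = c\<close> by (simp add: complex_eq_iff)
qed fact+

section \<open>Excluding the angle relation for n = 3, 4 and 6\<close>

lemma triangular_pyramid_angles:
  fixes p q :: nat and h \<alpha> \<beta> z :: real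
  assumes pq: "p > 0" "q > 0" "coprime p q" and h: "h > 0" "1 + h\<^sup>2 = 3 * (p / q)\<^sup>2"
    and \<alpha>: "0 < \<alpha>" "\<alpha> < pi / 2" "tan \<alpha> = 2 * h"
    and \<beta>: "0 \<le> \<beta>" "\<beta> \<le> pi" "cos \<beta> = - (1 - 2 * h\<^sup>2) / (1 + 4 * h\<^sup>2)"
    and z: "z \<in> \<rat>"
  shows "q * \<alpha> + p * \<beta> \<noteq> z * pi"
proof -
  \<comment> \<open>Scaling by \<open>q\<close> makes H^2 an integer. Then w = q + 2 H i has
    argument \<alpha>, and V = 2 p^2 - q^2 + 2 p H i has argument \<beta>.\<close>
  define H where "H = q * h"
  have H: "H > 0" "H\<^sup>2 = 3 * (real p)\<^sup>2 - (real q)\<^sup>2"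
    using h pq by (simp_all add: H_def power_mult_distrib field_simps)
  have pos: "4 * (real p)\<^sup>2 - (real q)\<^sup>2 > 0"
    using H by (smt (verit) zero_less_power zero_le_power2)
  have cos\<beta>: "cos \<beta> = (2 * (real p)\<^sup>2 - (real q)\<^sup>2) / (4 * (real p)\<^sup>2 - (real q)\<^sup>2)"
  proof -
    have "(real q)\<^sup>2 * h\<^sup>2 = 3 * (real p)\<^sup>2 - (real q)\<^sup>2"
      using H(2) by (simp add: H_def power_mult_distrib)
    moreover have "1 + 4 * h\<^sup>2 \<noteq> 0" by (smt (verit) zero_le_power2)
    ultimately show ?thesis unfolding \<beta>(3) using pos by (subst frac_eq_eq) (auto, algebra)
  qed
  have pq': "real q < 2 * real p"
    using pos by (intro power2_less_imp_less[of "real q"]) (simp_all add: power_mult_distrib)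
  consider l where "prime l" "l dvd 2 * p + q" "l > 2" | "8 dvd 2 * p + q" | "2 * p + q \<in> {1, 2, 4}"
    using odd_prime_factor_cases[of "2 * p + q"] pq by auto
  then show ?thesis
  proof cases
    case 1
    note l = prime_dvd_double_add[OF 1(1,2) pq(3) 1(3)]
    have *: "prime (int l)" using 1 by simp
    show ?thesis
    \<comment> \<open>The value of \<open>x\<close> is the factorisation 2 p^2 - q^2 - p q = (2 p +
      q) (p - q) of V - p w.\<close>
    proof (rule angles_not_rational_real[where l = "int l" and T = "2 * int q" and a = q and b = "2 * H"
            and M = "3 * (2 * int p - int q) * (2 * int p + int q)" and y = "int p"
            and x = "(2 * int p + int q) * (int p - int q)" and d = "2 * p * H"
            and c = "2 * (real p)\<^sup>2 - (real q)\<^sup>2" and N = "4 * (real p)\<^sup>2 - (real q)\<^sup>2"])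
      show "\<not> int l dvd 2 * int q" using * l by (simp add: prime_dvd_mult_iff)
      show "int l dvd 3 * (2 * int p - int q) * (2 * int p + int q)"
        "int l dvd (2 * int p + int q) * (int p - int q)"
        using l(4) by (rule dvd_mult dvd_mult2)+
      show "q * tan \<alpha> = 2 * H" by (simp add: \<alpha> H_def)
      show "(2 * (real p)\<^sup>2 - (real q)\<^sup>2)\<^sup>2 + (2 * p * H)\<^sup>2 = (4 * (real p)\<^sup>2 - (real q)\<^sup>2)\<^sup>2"
        by (simp add: power_mult_distrib H(2)) (simp add: power2_eq_square algebra_simps)
    qed (use * l H pq \<alpha> \<beta>(1,2) cos\<beta> pos z in
        \<open>simp_all add: power_mult_distrib algebra_simps power2_eq_square\<close>)
  next
    case 2
    obtain q' where q': "q = 2 * q'" "odd p" "odd q'" "4 dvd p + q'"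
      using eight_dvd_double_add[OF 2 pq(3)] by blast
    then obtain j where j: "p + q' = 4 * j" by (auto elim: dvdE)
    then have p: "int p = 4 * int j - int q'" "real p = 4 * real j - real q'" by linarith+
    show ?thesis
    \<comment> \<open>Both \<open>w\<close> and \<open>V\<close> are divided by 4. With p + q' = 4 j
      the new trace q' is odd, while the new norm is even because \<open>p\<close> and q' are
      odd.\<close>
    proof (rule angles_not_rational_real[where l = 2 and T = "int q'" and a = "q' / 2" and b = "H / 2"
            and M = "3 * int j * (int p - int q')" and y = "int p"
            and x = "2 * int j * (int p - 2 * int q')" and d = "p * (H / 2)"
            and c = "((real p)\<^sup>2 - 2 * (real q')\<^sup>2) / 2" and N = "(real p)\<^sup>2 - (real q')\<^sup>2"])
      show "q' / 2 * tan \<alpha> = H / 2" using q' by (simp add: \<alpha> H_def)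
      show "cos \<beta> = ((real p)\<^sup>2 - 2 * (real q')\<^sup>2) / 2 / ((real p)\<^sup>2 - (real q')\<^sup>2)"
      proof -
        have "2 * (real p)\<^sup>2 - (real q)\<^sup>2 = 4 * (((real p)\<^sup>2 - 2 * (real q')\<^sup>2) / 2)"
          "4 * (real p)\<^sup>2 - (real q)\<^sup>2 = 4 * ((real p)\<^sup>2 - (real q')\<^sup>2)"
          by (simp_all add: q' power_mult_distrib)
        then show ?thesis
          unfolding cos\<beta> by (simp only: mult_divide_mult_cancel_left zero_neq_numeral[symmetric] not_False_eq_True)
      qed
      show "(((real p)\<^sup>2 - 2 * (real q')\<^sup>2) / 2)\<^sup>2 + (p * (H / 2))\<^sup>2 = ((real p)\<^sup>2 - (real q')\<^sup>2)\<^sup>2"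
        by (simp add: power_mult_distrib power_divide H(2) q') (simp add: power2_eq_square field_simps)
      show "of_int (3 * int j * (int p - int q')) = (q' / 2)\<^sup>2 + (H / 2)\<^sup>2"
        by (simp add: power_mult_distrib power_divide H(2) q') (simp add: p power2_eq_square field_simps)
      show "((real p)\<^sup>2 - 2 * (real q')\<^sup>2) / 2
          = of_int (2 * int j * (int p - 2 * int q')) + of_int (int p) * (q' / 2)"
        by (simp add: p power2_eq_square field_simps)
      show "2 dvd 3 * int j * (int p - int q')" using q' by simp
      show "\<not> 2 dvd int q'" "\<not> 2 dvd int p" using q' by simp_all
    qed (use H pq \<alpha> \<beta>(1,2) pos q' z in \<open>simp_all add: power_mult_distrib\<close>)
  next
    case 3
    \<comment> \<open>The sum is at least 3, and 2 p + q = 4 would need p = 1 and q = 2, which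
      violates the strict inequality.\<close>
    moreover have "q < 2 * p" using pq' by linarith
    ultimately have False using pq(2) by (simp only: insert_iff empty_iff) presburger
    then show ?thesis ..
  qed
qed

lemma square_pyramid_angles:
  fixes p q :: nat and h \<alpha> \<beta> z :: real
  assumes pq: "p > 0" "q > 0" "coprime p q" and h: "h > 0" "1 + h\<^sup>2 = 2 * (p / q)\<^sup>2"
    and \<alpha>: "0 < \<alpha>" "\<alpha> < pi / 2" "tan \<alpha> = sqrt 2 * h"
    and \<beta>: "0 \<le> \<beta>" "\<beta> \<le> pi" "cos \<beta> = - 1 / (1 + 2 * h\<^sup>2)"
    and z: "z \<in> \<rat>"
  shows "q * \<alpha> + p * \<beta> \<noteq> z * pi"
proof -
  \<comment> \<open>The factor sqrt 2 of the tangent is absorbed into \<open>H\<close>. Here w = q +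
    H i and V = - q^2 + 2 p H i = - q (2 p + q) + 2 p w.\<close>
  define H where "H = q * (sqrt 2 * h)"
  have H: "H > 0" "H\<^sup>2 = 4 * (real p)\<^sup>2 - 2 * (real q)\<^sup>2"
    using h pq by (simp_all add: H_def power_mult_distrib field_simps)
  have pos: "4 * (real p)\<^sup>2 - (real q)\<^sup>2 > 0"
    using H by (smt (verit) zero_less_power zero_le_power2)
  have cos\<beta>: "cos \<beta> = - (real q)\<^sup>2 / (4 * (real p)\<^sup>2 - (real q)\<^sup>2)"
  proof -
    have "2 * (real q)\<^sup>2 * h\<^sup>2 = 4 * (real p)\<^sup>2 - 2 * (real q)\<^sup>2"
      using H(2) by (simp add: H_def power_mult_distrib)
    moreover have "1 + 2 * h\<^sup>2 \<noteq> 0" by (smt (verit) zero_le_power2)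
    ultimately show ?thesis unfolding \<beta>(3) using pos by (subst frac_eq_eq) (auto, algebra)
  qed
  have pq': "real q < 2 * real p"
    using pos by (intro power2_less_imp_less[of "real q"]) (simp_all add: power_mult_distrib)
  consider l where "prime l" "l dvd 2 * p + q" "l > 2" | "8 dvd 2 * p + q" | "2 * p + q \<in> {1, 2, 4}"
    using odd_prime_factor_cases[of "2 * p + q"] pq by auto
  then show ?thesis
  proof cases
    case 1
    note l = prime_dvd_double_add[OF 1(1,2) pq(3) 1(3)]
    have *: "prime (int l)" using 1 by simp
    show ?thesis
    proof (rule angles_not_rational_real[where l = "int l" and T = "2 * int q" and a = q and b = H
            and M = "(2 * int p - int q) * (2 * int p + int q)" and y = "2 * int p"
            and x = "(2 * int p + int q) * (- int q)" and d = "2 * p * H"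
            and c = "- (real q)\<^sup>2" and N = "4 * (real p)\<^sup>2 - (real q)\<^sup>2"])
      show "\<not> int l dvd 2 * int q" "\<not> int l dvd 2 * int p" using * l by (simp_all add: prime_dvd_mult_iff)
      show "int l dvd (2 * int p - int q) * (2 * int p + int q)"
        "int l dvd (2 * int p + int q) * (- int q)"
        using l(4) by (rule dvd_mult dvd_mult2)+
      show "q * tan \<alpha> = H" by (simp add: \<alpha> H_def)
      show "(- (real q)\<^sup>2)\<^sup>2 + (2 * p * H)\<^sup>2 = (4 * (real p)\<^sup>2 - (real q)\<^sup>2)\<^sup>2"
        using H(2) by (simp, algebra)
    qed (use * l H pq \<alpha> \<beta>(1,2) cos\<beta> pos z in
        \<open>simp_all add: power_mult_distrib algebra_simps power2_eq_square\<close>)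
  next
    case 2
    obtain q' where q': "q = 2 * q'" "odd p" "odd q'" "4 dvd p + q'"
      using eight_dvd_double_add[OF 2 pq(3)] by blast
    then obtain j where j: "p + q' = 4 * j" by (auto elim: dvdE)
    then have p: "int p = 4 * int j - int q'" "real p = 4 * real j - real q'" by linarith+
    show ?thesis
    \<comment> \<open>Here \<open>w\<close> is divided by 4 but \<open>V\<close> by 8: after
      division by 4 the coefficient of the new \<open>w\<close> in \<open>V\<close> would be 2 p,
      which is even.\<close>
    proof (rule angles_not_rational_real[where l = 2 and T = "int q'" and a = "q' / 2" and b = "H / 4"
            and M = "int j * (int p - int q')" and y = "int p"
            and x = "2 * int j * (- int q')" and d = "p * (H / 4)"
            and c = "- (real q')\<^sup>2 / 2" and N = "((real p)\<^sup>2 - (real q')\<^sup>2) / 2"])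
      show "q' / 2 * tan \<alpha> = H / 4" using q' by (simp add: \<alpha> H_def)
      show "cos \<beta> = - (real q')\<^sup>2 / 2 / (((real p)\<^sup>2 - (real q')\<^sup>2) / 2)"
      proof -
        have "- (real q)\<^sup>2 = 8 * (- (real q')\<^sup>2 / 2)"
          "4 * (real p)\<^sup>2 - (real q)\<^sup>2 = 8 * (((real p)\<^sup>2 - (real q')\<^sup>2) / 2)"
          by (simp_all add: q' power_mult_distrib)
        then show ?thesis
          unfolding cos\<beta> by (simp only: mult_divide_mult_cancel_left zero_neq_numeral[symmetric] not_False_eq_True)
      qed
      show "(- (real q')\<^sup>2 / 2)\<^sup>2 + (p * (H / 4))\<^sup>2 = (((real p)\<^sup>2 - (real q')\<^sup>2) / 2)\<^sup>2"
        by (simp add: power_mult_distrib power_divide H(2) q') (simp add: power2_eq_square power4_eq_xxxx field_simps)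
      show "of_int (int j * (int p - int q')) = (q' / 2)\<^sup>2 + (H / 4)\<^sup>2"
        by (simp add: power_mult_distrib power_divide H(2) q') (simp add: p power2_eq_square field_simps)
      show "- (real q')\<^sup>2 / 2
          = of_int (2 * int j * (- int q')) + of_int (int p) * (q' / 2)"
        by (simp add: p power2_eq_square field_simps)
      show "2 dvd int j * (int p - int q')" using q' by simp
      show "\<not> 2 dvd int q'" "\<not> 2 dvd int p" using q' by simp_all
    qed (use H pq \<alpha> \<beta>(1,2) pos q' z in \<open>simp_all add: power_mult_distrib\<close>)
  next
    case 3
    moreover have "q < 2 * p" using pq' by linarith
    ultimately have False using pq(2) by (simp only: insert_iff empty_iff) presburger
    then show ?thesis ..
  qed
qed

text \<open>For \<open>p / q = 5 / 2\<close> no prime factor of \<open>2 p + q\<close> helps; here \<open>tan \<alpha> = \<surd>7\<close> and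
  \<open>cos \<beta> = - cos (6 \<alpha>)\<close>.\<close>

lemma hexagonal_pyramid_angles_exceptional:
  fixes \<alpha> \<beta> z :: real
  assumes \<alpha>: "0 < \<alpha>" "\<alpha> < pi / 2" "tan \<alpha> = sqrt 7"
    and \<beta>: "cos \<beta> = - 9 / 16" and z: "z \<in> \<rat>"
  shows "2 * \<alpha> + 5 * \<beta> \<noteq> z * pi"
proof
  assume eq: "2 * \<alpha> + 5 * \<beta> = z * pi"
  have irrational: "\<alpha> \<noteq> y * pi" if "y \<in> \<rat>" for y
  proof -
    have "cos \<alpha> > 0" using \<alpha> by (intro cos_gt_zero_pi) auto
    then have c: "sqrt 7 * cos \<alpha> = sin \<alpha>" using \<alpha>(3) by (simp add: tan_def field_simps)
    have "1 * \<alpha> + 0 * \<alpha> \<noteq> y * pi"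
    \<comment> \<open>With exponents 1 and 0 the criterion speaks about \<alpha> alone. The integer
      (1 + sqrt (-7)) / 2 has argument \<alpha>, norm 2 and trace 1.\<close>
    proof (rule angles_not_rational[where l = 2 and T = 1 and M = 2 and q = 1 and p = 0
          and w = "Complex (1 / 2) (sqrt 7 / 2)", unfolded of_nat_0 of_nat_1])
      show "Complex (1 / 2) (sqrt 7 / 2) \<in> nonreal_combinations (Complex (1 / 2) (sqrt 7 / 2)) 2"
        by (rule nonreal_combinationsI[of _ 0 1]) auto
      show eq: "Complex (1 / 2) (sqrt 7 / 2) = of_real (1 / (2 * cos \<alpha>)) * cis \<alpha>"
        using \<open>cos \<alpha> > 0\<close> c by (simp add: complex_eq_iff field_simps)
      show "Complex (1 / 2) (sqrt 7 / 2) = of_real (1 / (2 * cos \<alpha>)) * cis \<alpha>" by (rule eq)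
    qed (use that in \<open>simp_all add: complex_eq_iff power2_eq_square\<close>)
    then show ?thesis by simp
  qed
  have "cos (2 * \<alpha>) = (1 - (sqrt 7)\<^sup>2) / (1 + (sqrt 7)\<^sup>2)"
  proof -
    have "cos \<alpha> > 0" using \<alpha> by (intro cos_gt_zero_pi) auto
    then have "sin \<alpha> = sqrt 7 * cos \<alpha>" using \<alpha>(3) by (simp add: tan_def field_simps)
    then have s: "(sin \<alpha>)\<^sup>2 = 7 * (cos \<alpha>)\<^sup>2" by (simp add: power_mult_distrib)
    then have "(cos \<alpha>)\<^sup>2 = 1 / 8" using sin_cos_squared_add[of \<alpha>] by simp
    then show ?thesis using s by (simp add: cos_double)
  qed
  then have c2: "cos (2 * \<alpha>) = - 3 / 4" by simp
  have "cos (3 * (2 * \<alpha>)) = 9 / 16"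
    unfolding cos_treble_cos c2 by (simp add: power3_eq_cube)
  then have "cos \<beta> = cos (pi - 6 * \<alpha>)" using \<beta> by (simp add: cos_diff)
  then obtain n where n: "n \<in> \<int>" "\<beta> = pi - 6 * \<alpha> + 2 * n * pi \<or> \<beta> = - (pi - 6 * \<alpha>) + 2 * n * pi"
    unfolding cos_eq by blast
  \<comment> \<open>Eliminating \<beta> from 2 \<alpha> + 5 \<beta> leaves \<alpha> with coefficient
    2 - 30 or 2 + 30, in neither case zero.\<close>
  from n(2) have "\<alpha> = ((5 + 10 * n - z) / 28) * pi \<or> \<alpha> = ((z + 5 - 10 * n) / 32) * pi"
  proof
    assume "\<beta> = pi - 6 * \<alpha> + 2 * n * pi"
    then have "28 * \<alpha> = (5 + 10 * n - z) * pi" using eq by (simp add: algebra_simps)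
    then show ?thesis by (simp add: field_simps)
  next
    assume "\<beta> = - (pi - 6 * \<alpha>) + 2 * n * pi"
    then have "32 * \<alpha> = (z + 5 - 10 * n) * pi" using eq by (simp add: algebra_simps)
    then show ?thesis by (simp add: field_simps)
  qed
  moreover have "n \<in> \<rat>" using n(1) Ints_subset_Rats by blast
  then have "(5 + 10 * n - z) / 28 \<in> \<rat>" "(z + 5 - 10 * n) / 32 \<in> \<rat>" using z by auto
  ultimately show False using irrational by blast
qed

lemma hexagonal_pyramid_angles:
  fixes p q :: nat and h \<alpha> \<beta> z :: real
  assumes pq: "p > 0" "q > 0" "coprime p q" and h: "h > 0" "1 + h\<^sup>2 = (p / q)\<^sup>2"
    and \<alpha>: "0 < \<alpha>" "\<alpha> < pi / 2" "tan \<alpha> = 2 * h / sqrt 3"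
    and \<beta>: "0 \<le> \<beta>" "\<beta> \<le> pi" "cos \<beta> = - (3 + 2 * h\<^sup>2) / (3 + 4 * h\<^sup>2)"
    and z: "z \<in> \<rat>"
  shows "q * \<alpha> + p * \<beta> \<noteq> z * pi"
proof -
  \<comment> \<open>Here w = 3 q + 2 H i and V = - (2 p^2 + q^2) + 2 p H i = - (2 p + q) (p + q) + p
    w. The trace 6 q of \<open>w\<close> is what sets the prime 3 apart.\<close>
  define H where "H = q * (sqrt 3 * h)"
  have H: "H > 0" "H\<^sup>2 = 3 * (real p)\<^sup>2 - 3 * (real q)\<^sup>2"
    using h pq by (simp_all add: H_def power_mult_distrib field_simps)
  have tan: "3 * q * tan \<alpha> = 2 * H" 
    by (simp add: \<alpha> H_def field_simps)
  have pos: "4 * (real p)\<^sup>2 - (real q)\<^sup>2 > 0"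
    using H by (smt (verit) zero_less_power zero_le_power2)
  have cos\<beta>: "cos \<beta> = - (2 * (real p)\<^sup>2 + (real q)\<^sup>2) / (4 * (real p)\<^sup>2 - (real q)\<^sup>2)"
  proof -
    have "3 * (real q)\<^sup>2 * h\<^sup>2 = 3 * (real p)\<^sup>2 - 3 * (real q)\<^sup>2"
      using H(2) by (simp add: H_def power_mult_distrib)
    moreover have "3 + 4 * h\<^sup>2 \<noteq> 0" by (smt (verit) zero_le_power2)
    ultimately show ?thesis unfolding \<beta>(3) using pos by (subst frac_eq_eq) (auto, algebra)
  qed
  have pq': "real q < real p"
  proof (rule power2_less_imp_less)
    show "(real q)\<^sup>2 < (real p)\<^sup>2" using H by (smt (verit) zero_less_power)
  qed simp
  consider l where "prime l" "l dvd 2 * p + q" "l > 3" | "9 dvd 2 * p + q" | "8 dvd 2 * p + q"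
    | "2 * p + q \<in> {1, 2, 4, 3, 6, 12}"
    using prime_factor_cases[of "2 * p + q"] pq by auto
  then show ?thesis
  proof cases
    case 1
    have "l > 2" using 1 by simp
    note l = prime_dvd_double_add[OF 1(1,2) pq(3) this]
    have *: "prime (int l)" using 1 by simp
    have "\<not> int l dvd 3" using 1(3) zdvd_imp_le[of "int l" 3] by auto
    then have "\<not> int l dvd 2 * (3 * int q)" using * l by (simp only: prime_dvd_mult_iff simp_thms)
    then have T: "\<not> int l dvd 6 * int q" by simp
    show ?thesis
    proof (rule angles_not_rational_real[where l = "int l" and T = "6 * int q" and a = "3 * q" and b = "2 * H"
            and M = "3 * (2 * int p - int q) * (2 * int p + int q)" and y = "int p"
            and x = "(2 * int p + int q) * (- (int p + int q))" and d = "2 * p * H"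
            and c = "- (2 * (real p)\<^sup>2 + (real q)\<^sup>2)" and N = "4 * (real p)\<^sup>2 - (real q)\<^sup>2"])
      show "int l dvd 3 * (2 * int p - int q) * (2 * int p + int q)"
        "int l dvd (2 * int p + int q) * (- (int p + int q))"
        using l(4) by (rule dvd_mult dvd_mult2)+
      show "(- (2 * (real p)\<^sup>2 + (real q)\<^sup>2))\<^sup>2 + (2 * p * H)\<^sup>2 = (4 * (real p)\<^sup>2 - (real q)\<^sup>2)\<^sup>2"
        by (simp add: power_mult_distrib H(2)) (simp add: power2_eq_square algebra_simps)
      show "of_int (3 * (2 * int p - int q) * (2 * int p + int q)) = (real (3 * q))\<^sup>2 + (2 * H)\<^sup>2"
        by (simp add: power_mult_distrib H(2)) (simp add: power2_eq_square algebra_simps)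
    qed (use * l T H pq \<alpha>(1,2) tan \<beta>(1,2) cos\<beta> pos z in
        \<open>simp_all add: algebra_simps power2_eq_square\<close>)
  next
    case 2
    then obtain j where j: "2 * p + q = 9 * j" by (auto elim: dvdE)
    then have jq: "int q = 9 * int j - 2 * int p" "real q = 9 * real j - 2 * real p" by linarith+
    have "3 dvd 2 * p + q" using 2 by presburger
    then have l: "\<not> 3 dvd int p" "\<not> 3 dvd int q"
      using prime_dvd_double_add[of 3 p q] pq(3) by auto
    then have T: "\<not> 3 dvd 2 * int q" by presburger
    show ?thesis
    \<comment> \<open>Dividing \<open>w\<close> and \<open>V\<close> by 3 lowers the trace to 2 q,
      and one factor 3 of 2 p + q = 9 j survives in the new norm and in \<open>x\<close>.\<close>
    proof (rule angles_not_rational_real[where l = 3 and T = "2 * int q" and a = q and b = "2 * H / 3"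
            and M = "3 * int j * (2 * int p - int q)" and y = "int p"
            and x = "3 * int j * (- (int p + int q))" and d = "p * (2 * H / 3)"
            and c = "- (2 * (real p)\<^sup>2 + (real q)\<^sup>2) / 3" and N = "(4 * (real p)\<^sup>2 - (real q)\<^sup>2) / 3"])
      show "(- (2 * (real p)\<^sup>2 + (real q)\<^sup>2) / 3)\<^sup>2 + (p * (2 * H / 3))\<^sup>2
          = ((4 * (real p)\<^sup>2 - (real q)\<^sup>2) / 3)\<^sup>2"
        by (simp add: power_mult_distrib power_divide H(2)) (simp add: power2_eq_square field_simps)
      show "of_int (3 * int j * (2 * int p - int q)) = (real q)\<^sup>2 + (2 * H / 3)\<^sup>2"
        by (simp add: power_mult_distrib power_divide H(2)) (simp add: jq power2_eq_square field_simps)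
      show "- (2 * (real p)\<^sup>2 + (real q)\<^sup>2) / 3
          = of_int (3 * int j * (- (int p + int q))) + of_int (int p) * real q"
        by (simp add: jq power2_eq_square field_simps)
      show "cos \<beta> = - (2 * (real p)\<^sup>2 + (real q)\<^sup>2) / 3 / ((4 * (real p)\<^sup>2 - (real q)\<^sup>2) / 3)"
      proof -
        have "A / 3 / (B / 3) = A / B" for A B :: real by simp
        then show ?thesis unfolding cos\<beta> by metis
      qed
    qed (use l T H pq \<alpha>(1,2) tan \<beta>(1,2) pos z in simp_all)
  next
    case 3
    obtain q' where q': "q = 2 * q'" "odd p" "odd q'" "4 dvd p + q'"
      using eight_dvd_double_add[OF 3 pq(3)] by blast
    then obtain j where j: "p + q' = 4 * j" by (auto elim: dvdE)
    then have p: "int p = 4 * int j - int q'" "real p = 4 * real j - real q'" by linarith+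
    show ?thesis
    proof (rule angles_not_rational_real[where l = 2 and T = "3 * int q'" and a = "3 * q' / 2" and b = "H / 2"
            and M = "3 * int j * (int p - int q')" and y = "int p"
            and x = "2 * int j * (- (int p + 2 * int q'))" and d = "p * (H / 2)"
            and c = "- ((real p)\<^sup>2 + 2 * (real q')\<^sup>2) / 2" and N = "(real p)\<^sup>2 - (real q')\<^sup>2"])
      show "real (3 * q') / 2 * tan \<alpha> = H / 2" using q' tan by simp
      show "cos \<beta> = - ((real p)\<^sup>2 + 2 * (real q')\<^sup>2) / 2 / ((real p)\<^sup>2 - (real q')\<^sup>2)"
      proof -
        have "- (2 * (real p)\<^sup>2 + (real q)\<^sup>2) = 4 * (- ((real p)\<^sup>2 + 2 * (real q')\<^sup>2) / 2)"
          "4 * (real p)\<^sup>2 - (real q)\<^sup>2 = 4 * ((real p)\<^sup>2 - (real q')\<^sup>2)"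
          by (simp_all add: q' power_mult_distrib)
        then show ?thesis
          unfolding cos\<beta> by (simp only: mult_divide_mult_cancel_left zero_neq_numeral[symmetric] not_False_eq_True)
      qed
      show "(- ((real p)\<^sup>2 + 2 * (real q')\<^sup>2) / 2)\<^sup>2 + (p * (H / 2))\<^sup>2 = ((real p)\<^sup>2 - (real q')\<^sup>2)\<^sup>2"
        by (simp add: power_mult_distrib power_divide H(2) q') (simp add: power2_eq_square field_simps)
      show "of_int (3 * int j * (int p - int q')) = (real (3 * q') / 2)\<^sup>2 + (H / 2)\<^sup>2"
        by (simp add: power_mult_distrib power_divide H(2) q') (simp add: p power2_eq_square field_simps)
      show "- ((real p)\<^sup>2 + 2 * (real q')\<^sup>2) / 2
          = of_int (2 * int j * (- (int p + 2 * int q'))) + of_int (int p) * (real (3 * q') / 2)"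
        by (simp add: p power2_eq_square field_simps)
      show "2 dvd 3 * int j * (int p - int q')" using q' by simp
      show "\<not> 2 dvd 3 * int q'" "\<not> 2 dvd int p" using q' by simp_all
    qed (use H pq \<alpha>(1,2) \<beta>(1,2) pos q' z in \<open>simp_all add: power_mult_distrib\<close>)
  next
    case 4
    have less: "q < p" using pq' by linarith
    \<comment> \<open>For 0 < q < p the sum is at least 5; for 6 and 12 the number \<open>q\<close>
      is even, which leaves only q = 2 and p = 5.\<close>
    with 4 pq(2) have "2 * p + q = 12 \<and> q < 4" by (simp only: insert_iff empty_iff) presburger
    moreover have "q = 1 \<or> q = 2 \<or> q = 3" using pq(2) calculation by presburger
    ultimately have "q = 2" "p = 5" by presburger+
    have "h\<^sup>2 = 21 / 4" using h(2) by (simp add: \<open>q = 2\<close> \<open>p = 5\<close> power2_eq_square)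
    have "H\<^sup>2 = (3 * sqrt 7)\<^sup>2" by (simp add: H(2) \<open>q = 2\<close> \<open>p = 5\<close> power_mult_distrib)
    then have "H = 3 * sqrt 7" by (rule power2_eq_imp_eq) (use H(1) in simp_all)
    then have "tan \<alpha> = sqrt 7" using tan by (simp add: \<open>q = 2\<close>)
    moreover have "cos \<beta> = - 9 / 16" by (simp add: cos\<beta> \<open>q = 2\<close> \<open>p = 5\<close>)
    ultimately show ?thesis
      using hexagonal_pyramid_angles_exceptional[OF \<alpha>(1,2) _ _ z, of \<beta>] by (simp add: \<open>q = 2\<close> \<open>p = 5\<close>)
  qed
qed

section \<open>Vanishing in the tensor product\<close>

lemma tensor_add_left: "(a + a') \<otimes>\<^sub>\<int> b = a \<otimes>\<^sub>\<int> b + a' \<otimes>\<^sub>\<int> b"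
  by transfer (simp add: tensor_rel_def bilinear_relations.left diff_diff_eq[symmetric])

lemma tensor_add_right: "a \<otimes>\<^sub>\<int> (b + b') = a \<otimes>\<^sub>\<int> b + a \<otimes>\<^sub>\<int> b'"
  by transfer (simp add: tensor_rel_def bilinear_relations.right diff_diff_eq[symmetric])

lemma tensor_zero_left: "0 \<otimes>\<^sub>\<int> b = 0"
  using tensor_add_left[of 0 0 b] by simp

lemma tensor_zero_right: "a \<otimes>\<^sub>\<int> 0 = 0"
  using tensor_add_right[of a 0 0] by simp

lemma mod_pi_add: "mod_pi (x + y) = mod_pi x + mod_pi y"
  by transfer (auto simp: cong_pi_def intro: exI[of _ 0])

lemma mod_pi_multiple: "mod_pi (of_int k * pi) = 0"
  by transfer (auto simp: cong_pi_def)

lemma tensor_nat_swap: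
  "(real m * a) \<otimes>\<^sub>\<int> mod_pi \<theta> = a \<otimes>\<^sub>\<int> mod_pi (real m * \<theta>)"
proof (induction m)
  case 0
  have "mod_pi 0 = 0" using mod_pi_multiple[of 0] by simp
  then show ?case by (simp add: tensor_zero_left tensor_zero_right)
next
  case (Suc m)
  then show ?case by (simp add: distrib_right mod_pi_add tensor_add_left tensor_add_right)
qed

text \<open>Lengths are divisible and the angle is torsion modulo pi: writing a = d (a / d) moves
  the denominator of \<open>z\<close> onto the angle, which becomes an integer multiple of
  pi.\<close>

lemma tensor_rational_angle:
  fixes a z :: real
  assumes "z \<in> \<rat>"
  shows "a \<otimes>\<^sub>\<int> mod_pi (z * pi) = 0"
proof -
  obtain c d :: int where cd: "d > 0" "z = of_int c / of_int d"
    using assms by (metis Rats_cases')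
  have "a \<otimes>\<^sub>\<int> mod_pi (z * pi) = (real (nat d) * (a / d)) \<otimes>\<^sub>\<int> mod_pi (z * pi)"
    using cd by simp
  also have "\<dots> = (a / d) \<otimes>\<^sub>\<int> mod_pi (of_int c * pi)"
    unfolding tensor_nat_swap using cd by simp
  finally show ?thesis by (simp add: mod_pi_multiple tensor_zero_right)
qed

section \<open>Homomorphisms out of the tensor product\<close>

definition free_eval ::
  "('a \<Rightarrow> 'b \<Rightarrow> real) \<Rightarrow> ('a \<times> 'b \<Rightarrow>\<^sub>0 int) \<Rightarrow> real" where
  "free_eval B x = (\<Sum>k\<in>Poly_Mapping.keys x. of_int (Poly_Mapping.lookup x k) * B (fst k) (snd k))"

lemma free_eval_superset:
  assumes "finite K" "Poly_Mapping.keys x \<subseteq> K"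
  shows "free_eval B x = (\<Sum>k\<in>K. of_int (Poly_Mapping.lookup x k) * B (fst k) (snd k))"
  unfolding free_eval_def
  by (rule sum.mono_neutral_left) (use assms in \<open>auto simp: in_keys_iff\<close>)

lemma free_eval_diff: "free_eval B (x - y) = free_eval B x - free_eval B y"
proof -
  let ?K = "Poly_Mapping.keys x \<union> Poly_Mapping.keys y"
  have "Poly_Mapping.keys (x - y) \<subseteq> ?K" by (rule keys_diff)
  then show ?thesis
    by (simp add: free_eval_superset[of ?K] lookup_minus left_diff_distrib sum_subtractf)
qed

lemma free_eval_add: "free_eval B (x + y) = free_eval B x + free_eval B y"
proof -
  have "free_eval B (0 :: _ \<Rightarrow>\<^sub>0 int) = 0" by (simp add: free_eval_def)
  then have "free_eval B (- y) = - free_eval B y" using free_eval_diff[of B 0 y] by simp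
  then show ?thesis using free_eval_diff[of B x "- y"] by simp
qed

lemma free_eval_single: "free_eval B (Poly_Mapping.single (a, b) 1) = B a b"
  by (simp add: free_eval_def)

lemma free_eval_bilinear_relations:
  assumes "\<And>a a' b. B (a + a') b = B a b + B a' b" "\<And>a b b'. B a (b + b') = B a b + B a b'"
    and "x \<in> bilinear_relations"
  shows "free_eval B x = 0"
  using assms(3)
  by induction (simp_all add: free_eval_diff free_eval_single assms(1,2), simp add: free_eval_def)

text \<open>One half of the universal property, for real values: a biadditive \<open>B\<close>
  extends additively to the free abelian group and kills the defining relations, so it can be
  evaluated on a vanishing tensor.\<close>

lemma tensor_combination_eq_0:
  fixes B :: "'a::ab_group_add \<Rightarrow> 'b::ab_group_add \<Rightarrow> real"
  assumes "\<And>a a' b. B (a + a') b = B a b + B a' b" "\<And>a b b'. B a (b + b') = B a b + B a b'"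
    and "a \<otimes>\<^sub>\<int> b + a' \<otimes>\<^sub>\<int> b' = 0"
  shows "B a b + B a' b' = 0"
proof -
  have "Poly_Mapping.single (a, b) 1 + Poly_Mapping.single (a', b') 1 \<in> bilinear_relations"
    using assms(3)
    by (simp add: tensor.abs_eq plus_tensor_product.abs_eq zero_tensor_product.abs_eq
        tensor_product.abs_eq_iff tensor_rel_def)
  then have "free_eval B (Poly_Mapping.single (a, b) 1 + Poly_Mapping.single (a', b') 1) = 0"
    by (rule free_eval_bilinear_relations[OF assms(1,2)])
  then show ?thesis by (simp add: free_eval_add free_eval_single)
qed

section \<open>Rational-linear functionals on the reals\<close>

interpretation rat_real: vector_space "\<lambda>(q::rat) (x::real). of_rat q * x"
  by standard (simp_all add: algebra_simps of_rat_add of_rat_mult)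

interpretation rat_real_pair: vector_space_pair
  "\<lambda>(q::rat) (x::real). of_rat q * x" "\<lambda>(q::rat) (x::real). of_rat q * x"
  by standard

lemma independent_pairI:
  fixes x y :: real
  assumes "x \<noteq> 0" "\<forall>z\<in>\<rat>. y \<noteq> z * x"
  shows "\<not> rat_real.dependent {y, x}" "y \<noteq> x"
proof -
  show "y \<noteq> x" using bspec[OF assms(2) Rats_1] by simp
  have "\<not> rat_real.dependent {x}" using assms(1) by (simp add: rat_real.dependent_single)
  moreover have "y \<notin> rat_real.span {x}"
    using bspec[OF assms(2) Rats_of_rat] by (auto simp only: rat_real.span_singleton)
  ultimately show "\<not> rat_real.dependent {y, x}" using \<open>y \<noteq> x\<close>
    by (simp add: rat_real.independent_insert)
qed

text \<open>The hypotheses say that \<open>x\<close> and \<open>y\<close> are independent over the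
  rationals; they extend to a Hamel basis, on which values are free.\<close>

lemma additive_functional:
  fixes x y u v :: real
  assumes "x \<noteq> 0" "\<forall>z\<in>\<rat>. y \<noteq> z * x"
  obtains f :: "real \<Rightarrow> real" where
    "\<And>a b. f (a + b) = f a + f b" "\<And>z a. z \<in> \<rat> \<Longrightarrow> f (z * a) = z * f a" "f x = u" "f y = v"
proof -
  have indep: "\<not> rat_real.dependent {y, x}" "y \<noteq> x"
    by (rule independent_pairI[OF assms])+
  obtain f where f: "Vector_Spaces.linear (\<lambda>(q::rat) (x::real). of_rat q * x) (\<lambda>(q::rat) (x::real). of_rat q * x) f"
      "\<forall>w\<in>{y, x}. f w = (if w = x then u else v)"
    using rat_real_pair.linear_independent_extend[OF indep(1), of "\<lambda>w. if w = x then u else v"] by blast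
  interpret f: Vector_Spaces.linear "\<lambda>(q::rat) (x::real). of_rat q * x" "\<lambda>(q::rat) (x::real). of_rat q * x" f
    by (rule f(1))
  show thesis
  proof (rule that[of f])
    show "f (z * a) = z * f a" if "z \<in> \<rat>" for z a
      using that f.scale by (auto simp: Rats_def)
  qed (use f(2) indep(2) f.add in auto)
qed

text \<open>Only additive functions vanishing on the integer multiples of pi descend to angles.
  Testing this inside the definition makes the lift total, and since the default is the zero map,
  the result is additive for every \<open>g\<close>.\<close>

lift_definition angle_eval :: "(real \<Rightarrow> real) \<Rightarrow> angle_mod_pi \<Rightarrow> real"
  is "\<lambda>g \<theta>. if (\<forall>a b. g (a + b) = g a + g b) \<and> (\<forall>k. g (of_int k * pi) = 0) then g \<theta> else 0"
proof -
  fix g :: "real \<Rightarrow> real" and x y :: real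
  assume "cong_pi x y"
  then obtain k :: int where "x = of_int k * pi + y" by (auto simp: cong_pi_def algebra_simps)
  then show "?thesis g x y" by simp
qed

lemma angle_eval_mod_pi:
  assumes "\<And>a b. g (a + b) = g a + g b" "\<And>k. g (of_int k * pi) = 0"
  shows "angle_eval g (mod_pi \<theta>) = g \<theta>"
  using assms by transfer auto

lemma angle_eval_add: "angle_eval g (a + b) = angle_eval g a + angle_eval g b"
  by transfer auto

text \<open>The tests are products f(length) g(angle). If \<open>a\<close> and \<open>l\<close> are
  independent over the rationals, \<open>f\<close> isolates either summand; if l = r a, the identity
  serves as \<open>f\<close> and the two terms combine to a g(\<alpha> + r \<beta>). An angle killed
  by every rational-linear \<open>g\<close> that vanishes on pi is a rational multiple of pi, as it
  would otherwise be independent of pi.\<close>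

theorem tensor_pair_vanishes:
  fixes a l \<alpha> \<beta> :: real
  assumes zero: "a \<otimes>\<^sub>\<int> mod_pi \<alpha> + l \<otimes>\<^sub>\<int> mod_pi \<beta> = 0" and "a \<noteq> 0"
  shows "(\<exists>z\<in>\<rat>. \<alpha> = z * pi) \<and> (\<exists>z\<in>\<rat>. \<beta> = z * pi) \<or>
    (\<exists>r\<in>\<rat>. l = r * a \<and> (\<exists>z\<in>\<rat>. \<alpha> + r * \<beta> = z * pi))"
proof -
  have key: "f a * g \<alpha> + f l * g \<beta> = 0"
    if f: "\<And>x y. f (x + y) = f x + f y"
      and g: "\<And>x y. g (x + y) = g x + g y" "\<And>k. g (of_int k * pi) = 0" for f g :: "real \<Rightarrow> real"
    using tensor_combination_eq_0[where B = "\<lambda>x y. f x * angle_eval g y", OF _ _ zero]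
    by (simp add: f angle_eval_add distrib_left distrib_right angle_eval_mod_pi[of g, OF g])
  have rational: "\<exists>z\<in>\<rat>. \<theta> = z * pi"
    if "\<And>g. \<lbrakk>\<And>x y. g (x + y) = g x + g y; \<And>z x. z \<in> \<rat> \<Longrightarrow> g (z * x) = z * g x; \<And>k. g (of_int k * pi) = 0\<rbrakk>
      \<Longrightarrow> g \<theta> = 0" for \<theta>
  proof (rule ccontr)
    assume "\<not> (\<exists>z\<in>\<rat>. \<theta> = z * pi)"
    then have irr: "\<forall>z\<in>\<rat>. \<theta> \<noteq> z * pi" by blast
    obtain g :: "real \<Rightarrow> real" where g: "\<And>x y. g (x + y) = g x + g y"
        "\<And>z x. z \<in> \<rat> \<Longrightarrow> g (z * x) = z * g x" "g pi = 0" "g \<theta> = 1"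
      by (rule additive_functional[OF pi_neq_zero irr, of 0 1]; rule that)
    have "g (of_int k * pi) = 0" for k using g(2)[of "of_int k" pi] g(3) by simp
    then have "g \<theta> = 0" using that[OF g(1,2)] by blast
    then show False using g(4) by simp
  qed
  show ?thesis
  proof (cases "\<exists>r\<in>\<rat>. l = r * a")
    case True
    then obtain r where r: "r \<in> \<rat>" "l = r * a" by blast
    have "\<exists>z\<in>\<rat>. \<alpha> + r * \<beta> = z * pi"
    proof (rule rational)
      fix g :: "real \<Rightarrow> real"
      assume g: "\<And>x y. g (x + y) = g x + g y" "\<And>z x. z \<in> \<rat> \<Longrightarrow> g (z * x) = z * g x"
        "\<And>k. g (of_int k * pi) = 0"
      have "a * g \<alpha> + l * g \<beta> = 0" by (rule key) (use g in auto)
      moreover have "g (\<alpha> + r * \<beta>) = g \<alpha> + r * g \<beta>" using g r by simp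
      ultimately have "a * g (\<alpha> + r * \<beta>) = 0" using r by (simp add: algebra_simps)
      then show "g (\<alpha> + r * \<beta>) = 0" using \<open>a \<noteq> 0\<close> by simp
    qed
    then show ?thesis using r by blast
  next
    case False
    then have indep: "\<forall>z\<in>\<rat>. l \<noteq> z * a" by blast
    obtain f1 :: "real \<Rightarrow> real" where f1: "\<And>x y. f1 (x + y) = f1 x + f1 y" "\<And>z x. z \<in> \<rat> \<Longrightarrow> f1 (z * x) = z * f1 x" "f1 a = 1" "f1 l = 0"
      by (rule additive_functional[OF \<open>a \<noteq> 0\<close> indep, of 1 0]; rule that)
    obtain f2 :: "real \<Rightarrow> real" where f2: "\<And>x y. f2 (x + y) = f2 x + f2 y" "\<And>z x. z \<in> \<rat> \<Longrightarrow> f2 (z * x) = z * f2 x" "f2 a = 0" "f2 l = 1"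
      by (rule additive_functional[OF \<open>a \<noteq> 0\<close> indep, of 0 1]; rule that)
    have "\<exists>z\<in>\<rat>. \<alpha> = z * pi" by (rule rational) (use key[of f1, OF f1(1)] f1(3,4) in simp)
    moreover have "\<exists>z\<in>\<rat>. \<beta> = z * pi" by (rule rational) (use key[of f2, OF f2(1)] f2(3,4) in simp)
    ultimately show ?thesis by blast
  qed
qed

section \<open>Dihedral angles from the normals of the adjacent facets\<close>

lemma orthogonal_to_edge_span:
  fixes m n d a :: "real^3"
  assumes "norm m = 1" "norm n = 1" "(m \<bullet> n)\<^sup>2 \<noteq> 1" "d \<noteq> 0" "d \<bullet> m = 0" "d \<bullet> n = 0" "d \<bullet> a = 0"
  obtains s t where "a = s *\<^sub>R m + t *\<^sub>R n"
proof -
  have "m \<notin> span {n}"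
  proof
    assume "m \<in> span {n}"
    then obtain c where "m = c *\<^sub>R n" by (auto simp: span_singleton)
    then have "m \<bullet> n = c" "\<bar>c\<bar> = 1" using assms(1,2) by (auto simp: dot_square_norm)
    then show False using assms(3) by (simp add: abs_square_eq_1)
  qed
  moreover have "n \<noteq> 0" using assms(2) by auto
  ultimately have ind: "independent {m, n}" "m \<noteq> n"
    by (auto simp: independent_insert span_base)
  have "span {m, n} = {x. d \<bullet> x = 0}"
  proof (rule subspace_dim_equal)
    show "span {m, n} \<subseteq> {x. d \<bullet> x = 0}"
      by (rule span_minimal) (use assms in \<open>auto simp: subspace_hyperplane\<close>)
    have "dim (span {m, n}) = 2" using ind by (simp add: dim_eq_card_independent)
    then show "dim (span {m, n}) \<ge> dim {x. d \<bullet> x = 0}"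
      using dim_hyperplane[OF assms(4)] by simp
  qed (simp_all add: subspace_hyperplane)
  then have "a \<in> span {m, n}" using assms(7) by blast
  then obtain s t where "a - s *\<^sub>R m = t *\<^sub>R n"
    by (auto simp: span_insert span_singleton)
  then show thesis using that[of s t] by (simp add: algebra_simps)
qed

text \<open>For outward unit normals \<open>m\<close> and \<open>n\<close> of two facets this is - n
  without its component along \<open>m\<close>, normalised by the sine of the angle between the
  normals: the direction inside the first facet, orthogonal to the edge, that leads away from the
  second.\<close>

definition inward_vector :: "real^3 \<Rightarrow> real^3 \<Rightarrow> real^3" where
  "inward_vector m n = (1 / sqrt (1 - (m \<bullet> n)\<^sup>2)) *\<^sub>R ((m \<bullet> n) *\<^sub>R m - n)"

lemma inner_unit_bound:
  fixes m n :: "real^3"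
  assumes "norm m = 1" "norm n = 1" "(m \<bullet> n)\<^sup>2 \<noteq> 1"
  shows "(m \<bullet> n)\<^sup>2 < 1"
proof -
  have "\<bar>m \<bullet> n\<bar> \<le> 1" using Cauchy_Schwarz_ineq2[of m n] assms by simp
  then have "(m \<bullet> n)\<^sup>2 \<le> 1" by (simp add: abs_square_le_1)
  then show ?thesis using assms(3) by simp
qed

lemma inward_vector_inner:
  fixes m n :: "real^3"
  assumes "norm m = 1" "norm n = 1" "(m \<bullet> n)\<^sup>2 \<noteq> 1"
  shows "inward_vector m n \<bullet> m = 0" "inward_vector m n \<bullet> n = - sqrt (1 - (m \<bullet> n)\<^sup>2)"
    "norm (inward_vector m n) = 1" "inward_vector m n \<bullet> inward_vector n m = - (m \<bullet> n)"
proof -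
  define k where "k = m \<bullet> n"
  have mn: "m \<bullet> m = 1" "n \<bullet> n = 1" "m \<bullet> n = k" "n \<bullet> m = k"
    using assms by (simp_all add: dot_square_norm k_def inner_commute)
  define \<sigma> where "\<sigma> = sqrt (1 - k\<^sup>2)"
  have \<sigma>: "\<sigma> > 0" "\<sigma>\<^sup>2 = 1 - k\<^sup>2"
    using inner_unit_bound[OF assms] by (simp_all add: \<sigma>_def k_def)
  have w: "inward_vector m n = (1 / \<sigma>) *\<^sub>R (k *\<^sub>R m - n)" "inward_vector n m = (1 / \<sigma>) *\<^sub>R (k *\<^sub>R n - m)"
    by (simp_all add: inward_vector_def mn \<sigma>_def)
  show "inward_vector m n \<bullet> m = 0" by (simp add: w inner_diff_left mn)
  show *: "inward_vector m n \<bullet> n = - sqrt (1 - (m \<bullet> n)\<^sup>2)"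
    unfolding mn \<sigma>_def[symmetric] using \<sigma>
    by (simp add: w inner_diff_left mn field_simps power2_eq_square)
  have "inward_vector m n \<bullet> inward_vector m n = (1 - k\<^sup>2) / \<sigma>\<^sup>2"
  proof -
    have "(k *\<^sub>R m - n) \<bullet> (k *\<^sub>R m - n) = 1 - k\<^sup>2"
      by (simp add: inner_diff_left inner_diff_right mn power2_eq_square)
    then show ?thesis by (simp add: w(1) power2_eq_square)
  qed
  also have "\<dots> = 1" using \<sigma> inner_unit_bound[OF assms] by (simp add: mn)
  finally show "norm (inward_vector m n) = 1" by (simp add: norm_eq_1)
  have "inward_vector m n \<bullet> inward_vector n m = - k * (1 - k\<^sup>2) / \<sigma>\<^sup>2"
  proof -
    have "(k *\<^sub>R m - n) \<bullet> (k *\<^sub>R n - m) = - k * (1 - k\<^sup>2)"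
      by (simp add: inner_diff_left inner_diff_right mn power2_eq_square algebra_simps)
    then show ?thesis by (simp add: w power2_eq_square)
  qed
  also have "\<dots> = - k" using \<sigma> inner_unit_bound[OF assms] by (simp add: mn)
  finally show "inward_vector m n \<bullet> inward_vector n m = - (m \<bullet> n)" by (simp add: k_def)
qed

text \<open>Orthogonality to the edge puts \<open>u\<close> into the span of \<open>m\<close> and
  \<open>n\<close>, and pointing into \<open>F\<close> makes it orthogonal to \<open>m\<close>. Two
  unit vectors remain, and \<open>n \<bullet> u \<le> 0\<close> selects one.\<close>

lemma inward_direction_unique:
  fixes m n p q u :: "real^3"
  assumes mn: "norm m = 1" "norm n = 1" "(m \<bullet> n)\<^sup>2 \<noteq> 1" and "p \<noteq> q"
    and e: "\<And>x. x \<in> closed_segment p q \<Longrightarrow> m \<bullet> x = c \<and> n \<bullet> x = c'"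
    and F: "\<And>x. x \<in> F \<Longrightarrow> m \<bullet> x = c \<and> n \<bullet> x \<le> c'"
    and u: "inward_direction (closed_segment p q) F u"
  shows "u = inward_vector m n"
proof -
  define d where "d = q - p"
  have d: "d \<noteq> 0" "d \<bullet> m = 0" "d \<bullet> n = 0"
    using assms(4) e[of p] e[of q] by (auto simp: d_def inner_diff_left inner_diff_right inner_commute)
  have "u \<bullet> (q - p) = 0" using u unfolding inward_direction_def by (meson ends_in_segment)
  then have "d \<bullet> u = 0" by (simp add: d_def inner_commute)
  then obtain s t where st: "u = s *\<^sub>R m + t *\<^sub>R n"
    using orthogonal_to_edge_span[OF mn d \<open>d \<bullet> u = 0\<close>] by blast
  obtain x r where x: "x \<in> closed_segment p q" "r > 0" "x + r *\<^sub>R u \<in> F" and "norm u = 1"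
    using u unfolding inward_direction_def by blast
  have "m \<bullet> u = 0" "n \<bullet> u \<le> 0"
    using e[OF x(1)] F[OF x(3)] x(2) by (simp_all add: inner_add_right mult_le_0_iff)
  moreover define k where "k = m \<bullet> n"
  have ip: "m \<bullet> m = 1" "n \<bullet> n = 1" "m \<bullet> n = k" "n \<bullet> m = k"
    using mn by (simp_all add: dot_square_norm k_def inner_commute)
  ultimately have "s + t * k = 0" and t': "s * k + t \<le> 0"
    by (simp_all add: st inner_add_right ip)
  then have s: "s = - t * k" by simp
  have t: "t * (1 - k\<^sup>2) \<le> 0" using t' by (simp add: s power2_eq_square algebra_simps)
  have k: "1 - k\<^sup>2 > 0" using inner_unit_bound[OF mn] by (simp add: k_def)
  have "1 = u \<bullet> u" using \<open>norm u = 1\<close> by (simp add: dot_square_norm)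
  also have "\<dots> = t\<^sup>2 * (1 - k\<^sup>2)"
  proof -
    have "(n - k *\<^sub>R m) \<bullet> (n - k *\<^sub>R m) = 1 - k\<^sup>2"
      by (simp add: inner_diff_left inner_diff_right ip power2_eq_square)
    moreover have "u = t *\<^sub>R (n - k *\<^sub>R m)" by (simp add: st s scaleR_diff_right)
    ultimately show ?thesis by (simp add: power2_eq_square)
  qed
  finally have "t\<^sup>2 = 1 / (1 - k\<^sup>2)" using k by (simp add: nonzero_eq_divide_eq)
  moreover have "t \<le> 0" using t k by (simp add: mult_le_0_iff)
  ultimately have t_eq: "t = - (1 / sqrt (1 - k\<^sup>2))"
    by (metis abs_of_nonpos minus_minus real_sqrt_abs real_sqrt_divide real_sqrt_one)
  show ?thesis
    unfolding st s t_eq inward_vector_def ip by (simp add: scaleR_diff_right)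
qed

lemma inward_direction_exists:
  fixes m n p q z :: "real^3"
  assumes mn: "norm m = 1" "norm n = 1" "(m \<bullet> n)\<^sup>2 \<noteq> 1" and "p \<noteq> q"
    and e: "\<And>x. x \<in> closed_segment p q \<Longrightarrow> m \<bullet> x = c \<and> n \<bullet> x = c'"
    and F: "convex F" "closed_segment p q \<subseteq> F" "z \<in> F" "m \<bullet> z = c" "n \<bullet> z < c'"
  shows "inward_direction (closed_segment p q) F (inward_vector m n)"
proof -
  define w where "w = inward_vector m n"
  note w = inward_vector_inner[OF mn, folded w_def]
  define \<sigma> where "\<sigma> = sqrt (1 - (m \<bullet> n)\<^sup>2)"
  have \<sigma>: "\<sigma> > 0" using inner_unit_bound[OF mn] by (simp add: \<sigma>_def)
  define d where "d = q - p"
  have d: "d \<noteq> 0" "d \<bullet> m = 0" "d \<bullet> n = 0"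
    using assms(4) e[of p] e[of q] by (auto simp: d_def inner_diff_left inner_diff_right inner_commute)
  have dw: "w \<bullet> d = 0"
    using d by (simp add: w_def inward_vector_def inner_diff_left inner_commute[of _ d] inner_diff_right)
  have orth: "w \<bullet> (x - y) = 0" if xy: "x \<in> closed_segment p q" "y \<in> closed_segment p q" for x y
  proof -
    obtain s t where st: "x = (1 - s) *\<^sub>R p + s *\<^sub>R q" "y = (1 - t) *\<^sub>R p + t *\<^sub>R q"
      using xy unfolding in_segment by blast
    have "x - y = (s - t) *\<^sub>R d" unfolding st d_def by (simp add: algebra_simps)
    then show ?thesis using dw by simp
  qed
  define x0 where "x0 = midpoint p q"
  have x0: "x0 \<in> closed_segment p q" by (simp add: x0_def)
  define b where "b = (c' - n \<bullet> z) / \<sigma>"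
  have b: "b > 0" using \<sigma> F(5) by (simp add: b_def)
  \<comment> \<open>The coefficient \<open>b\<close> is chosen so that the remainder is orthogonal
    to both normals and therefore parallel to the edge.\<close>
  define r where "r = z - x0 - b *\<^sub>R w"
  have r: "r \<bullet> m = 0" "r \<bullet> n = 0"
    using w(1,2) e[OF x0] F(4) \<sigma> unfolding \<sigma>_def[symmetric]
    by (simp_all add: r_def inner_diff_left b_def inner_commute[of z] inner_commute[of x0])
  define \<nu> where "\<nu> = (d \<bullet> r) / (d \<bullet> d)"
  have "d \<bullet> (r - \<nu> *\<^sub>R d) = 0" using d by (simp add: \<nu>_def inner_diff_right)
  from orthogonal_to_edge_span[OF mn d this]
  obtain s t where "r - \<nu> *\<^sub>R d = s *\<^sub>R m + t *\<^sub>R n" by blast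
  then have "(r - \<nu> *\<^sub>R d) \<bullet> (r - \<nu> *\<^sub>R d) = (r - \<nu> *\<^sub>R d) \<bullet> (s *\<^sub>R m + t *\<^sub>R n)" by simp
  also have "\<dots> = 0" using r d by (simp add: inner_add_right inner_diff_left)
  finally have "r = \<nu> *\<^sub>R d" by simp
  then have z: "z = x0 + b *\<^sub>R w + \<nu> *\<^sub>R d" unfolding r_def by (simp add: algebra_simps)
  \<comment> \<open>Moving from the midpoint towards \<open>z\<close> drifts along the edge.
    Starting from \<open>x0\<close> shifted by - \<mu> d cancels the drift, since
    \<open>(1 - \<epsilon>) * \<mu> = \<epsilon> * \<nu>\<close>, and \<bar>\<mu>\<bar> \<le> 1/2
    keeps the starting point on the edge.\<close>
  define \<epsilon> \<mu> where "\<epsilon> = 1 / (2 * (1 + \<bar>\<nu>\<bar>))" and "\<mu> = \<nu> / (1 + 2 * \<bar>\<nu>\<bar>)"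
  have \<epsilon>: "0 < \<epsilon>" "\<epsilon> \<le> 1" "(1 - \<epsilon>) * \<mu> = \<epsilon> * \<nu>"
  proof -
    have "1 - \<epsilon> = (1 + 2 * \<bar>\<nu>\<bar>) / (2 * (1 + \<bar>\<nu>\<bar>))" by (simp add: \<epsilon>_def field_simps)
    then show "(1 - \<epsilon>) * \<mu> = \<epsilon> * \<nu>" by (simp add: \<epsilon>_def \<mu>_def)
  qed (simp_all add: \<epsilon>_def field_simps)
  have \<mu>: "\<bar>\<mu>\<bar> \<le> 1 / 2" by (simp add: \<mu>_def abs_divide field_simps)
  have "x0 - \<mu> *\<^sub>R d = (1 - (1 / 2 - \<mu>)) *\<^sub>R p + (1 / 2 - \<mu>) *\<^sub>R q"
    by (simp add: x0_def d_def midpoint_def algebra_simps flip: scaleR_add_left)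
  moreover have "0 \<le> 1 / 2 - \<mu>" "1 / 2 - \<mu> \<le> 1" using \<mu> by auto
  ultimately have "x0 - \<mu> *\<^sub>R d \<in> closed_segment p q" unfolding in_segment by blast
  then have "x0 - \<mu> *\<^sub>R d \<in> F" using F(2) by blast
  then have "(1 - \<epsilon>) *\<^sub>R (x0 - \<mu> *\<^sub>R d) + \<epsilon> *\<^sub>R z \<in> F"
    using F(1,3) \<epsilon> by (simp add: convex_alt)
  also have "(1 - \<epsilon>) *\<^sub>R (x0 - \<mu> *\<^sub>R d) + \<epsilon> *\<^sub>R z
      = x0 + (\<epsilon> * b) *\<^sub>R w + (\<epsilon> * \<nu> - (1 - \<epsilon>) * \<mu>) *\<^sub>R d"
    unfolding z by (simp add: algebra_simps)
  finally have "x0 + (\<epsilon> * b) *\<^sub>R w \<in> F" using \<epsilon>(3) by simp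
  moreover have "\<epsilon> * b > 0" using \<epsilon> b by simp
  ultimately show ?thesis
    unfolding inward_direction_def w_def[symmetric] using w(3) orth x0 by blast
qed

section \<open>Two faces of a polytope that meet in a segment\<close>

locale two_faces =
  fixes P F G :: "(real^3) set" and m n :: "real^3" and c c' :: real and p q z z' :: "real^3"
  assumes P: "polytope P"
    and m: "norm m = 1" "\<And>x. x \<in> P \<Longrightarrow> m \<bullet> x \<le> c"
    and n: "norm n = 1" "\<And>x. x \<in> P \<Longrightarrow> n \<bullet> x \<le> c'"
    and F_def: "F = P \<inter> {x. m \<bullet> x = c}"
    and G_def: "G = P \<inter> {x. n \<bullet> x = c'}"
    and pq: "p \<noteq> q" "F \<inter> G = closed_segment p q"
    and z: "z \<in> F" "z \<notin> G" "z' \<in> G" "z' \<notin> F"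
begin

lemma convex_P: "convex P" by (rule polytope_imp_convex[OF P])

lemma faces: "F face_of P" "G face_of P" "closed_segment p q face_of P"
proof -
  show F: "F face_of P" unfolding F_def
    by (rule face_of_Int_supporting_hyperplane_le[OF convex_P m(2)])
  show G: "G face_of P" unfolding G_def
    by (rule face_of_Int_supporting_hyperplane_le[OF convex_P n(2)])
  show "closed_segment p q face_of P" using face_of_Int[OF F G] pq(2) by simp
qed

lemma aff_dim_edge: "aff_dim (closed_segment p q) = 1"
  using pq(1) by (simp add: segment_convex_hull aff_dim_convex_hull)

text \<open>The points \<open>z\<close> and \<open>z'\<close> make the edge a proper face of
  \<open>F\<close> and of \<open>G\<close>, and these proper faces of \<open>P\<close>. Dimension
  strictly grows along proper faces, so only 2 fits between 1 and 3.\<close>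

lemma aff_dims: "aff_dim P = 3" "aff_dim F = 2" "aff_dim G = 2"
proof -
  have sub: "F \<subseteq> P" "G \<subseteq> P" by (auto simp: F_def G_def)
  have "closed_segment p q face_of F" "closed_segment p q face_of G"
    using pq(2) sub by (auto intro!: face_of_subset[OF faces(3)])
  moreover have "closed_segment p q \<noteq> F" "closed_segment p q \<noteq> G" using z pq(2) by blast+
  ultimately have "1 < aff_dim F" "1 < aff_dim G"
    unfolding aff_dim_edge[symmetric]
    using face_of_aff_dim_lt face_of_imp_convex[OF faces(1)] face_of_imp_convex[OF faces(2)] by blast+
  moreover have "aff_dim F < aff_dim P" "aff_dim G < aff_dim P"
    using face_of_aff_dim_lt[OF convex_P] faces z sub by blast+
  moreover have "aff_dim P \<le> 3" using aff_dim_le_DIM[of P] by simp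
  ultimately show "aff_dim P = 3" "aff_dim F = 2" "aff_dim G = 2" by linarith+
qed

lemma edge: "closed_segment p q edge_of P"
  by (simp add: edge_of_def faces aff_dim_edge)

lemma facets: "F facet_of P" "G facet_of P"
  using faces aff_dims z by (auto simp: facet_of_def)

lemma edge_normals: "x \<in> closed_segment p q \<Longrightarrow> m \<bullet> x = c \<and> n \<bullet> x = c'"
  unfolding pq(2)[symmetric] by (auto simp: F_def G_def)

text \<open>Parallel normals would belong to the same hyperplane, because both hyperplanes contain
  the segment. Then \<open>F\<close> and \<open>G\<close> would coincide, contrary to
  \<open>z\<close> and \<open>z'\<close>.\<close>

lemma normals_not_parallel: "(m \<bullet> n)\<^sup>2 \<noteq> 1"
proof
  assume "(m \<bullet> n)\<^sup>2 = 1"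
  then have "m \<bullet> n = 1 \<or> m \<bullet> n = - 1" by (simp add: power2_eq_1_iff)
  then show False
  proof
    assume "m \<bullet> n = 1"
    moreover have "(m - n) \<bullet> (m - n) = m \<bullet> m - 2 * (m \<bullet> n) + n \<bullet> n"
      by (simp add: inner_diff_left inner_diff_right inner_commute)
    ultimately have "(m - n) \<bullet> (m - n) = 0" using m(1) n(1) by (simp only: dot_square_norm) simp
    then have "m = n" by simp
    then show False using edge_normals[of p] z by (auto simp: F_def G_def)
  next
    assume "m \<bullet> n = - 1"
    moreover have "(m + n) \<bullet> (m + n) = m \<bullet> m + 2 * (m \<bullet> n) + n \<bullet> n"
      by (simp add: inner_add_left inner_add_right inner_commute)
    ultimately have "(m + n) \<bullet> (m + n) = 0" using m(1) n(1) by (simp only: dot_square_norm) simp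
    then have n_eq: "n = - m" by (simp add: eq_neg_iff_add_eq_0 add.commute)
    then have "c' = - c" using edge_normals[of p] by auto
    then show False using n_eq n(2)[of z'] m(2)[of z'] z by (auto simp: F_def G_def)
  qed
qed

text \<open>A normal exposing \<open>H\<close> is orthogonal to the edge, hence equal to s m + t n,
  and testing it at \<open>z\<close> and \<open>z'\<close> gives \<open>s, t \<ge> 0\<close>. If
  both are positive, \<open>H\<close> satisfies both equalities and shrinks to the edge; otherwise
  it is one of the two faces.\<close>

lemma facets_containing_edge:
  assumes "H facet_of P" "closed_segment p q \<subseteq> H"
  shows "H = F \<or> H = G"
proof -
  have "H exposed_face_of P"
    using exposed_face_of_polyhedron[OF polytope_imp_polyhedron[OF P]] facet_of_imp_face_of[OF assms(1)]
    by simp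
  then obtain a b where ab: "\<And>x. x \<in> P \<Longrightarrow> a \<bullet> x \<le> b" "H = P \<inter> {x. a \<bullet> x = b}"
    by (auto simp: exposed_face_of_def)
  have "p \<in> H" "q \<in> H" using assms(2) by auto
  then have d: "q - p \<noteq> 0" "(q - p) \<bullet> m = 0" "(q - p) \<bullet> n = 0" "(q - p) \<bullet> a = 0"
    using pq(1) edge_normals[of p] edge_normals[of q] ab(2)
    by (auto simp: inner_diff_left inner_diff_right inner_commute)
  obtain s t where a: "a = s *\<^sub>R m + t *\<^sub>R n"
    using orthogonal_to_edge_span[OF m(1) n(1) normals_not_parallel d] by blast
  have "a \<bullet> p = b" using assms(2) ab(2) by auto
  then have b: "b = s * c + t * c'" using edge_normals[of p] by (simp add: a inner_add_left)
  have "a \<bullet> z \<le> b" "a \<bullet> z' \<le> b" using ab(1) z by (auto simp: F_def G_def)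
  moreover have zz: "m \<bullet> z = c" "n \<bullet> z < c'" "n \<bullet> z' = c'" "m \<bullet> z' < c"
    using z m(2)[of z'] n(2)[of z] by (auto simp: F_def G_def order_less_le)
  ultimately have "t * (n \<bullet> z - c') \<le> 0" "s * (m \<bullet> z' - c) \<le> 0"
    by (simp_all add: a b inner_add_left algebra_simps)
  then have st: "t \<ge> 0" "s \<ge> 0" using zz by (auto simp: mult_le_0_iff)
  have "H \<noteq> P" using assms(1) by auto
  then have nz: "s \<noteq> 0 \<or> t \<noteq> 0" using ab(2) a b by auto
  show ?thesis
  proof (cases "s = 0 \<or> t = 0")
    case True
    then show ?thesis
    proof
      assume "s = 0"
      then show ?thesis using nz by (simp add: ab(2) a b G_def)
    next
      assume "t = 0"
      then show ?thesis using nz by (simp add: ab(2) a b F_def)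
    qed
  next
    case False
    have "H \<subseteq> closed_segment p q"
    proof
      fix x assume x: "x \<in> H"
      then have "s * (c - m \<bullet> x) + t * (c' - n \<bullet> x) = 0"
        using ab(2) by (simp add: a b inner_add_left algebra_simps)
      moreover have "s * (c - m \<bullet> x) \<ge> 0" "t * (c' - n \<bullet> x) \<ge> 0"
        using st m(2)[of x] n(2)[of x] x ab(2) by auto
      ultimately have "s * (c - m \<bullet> x) = 0" "t * (c' - n \<bullet> x) = 0" by linarith+
      then show "x \<in> closed_segment p q"
        unfolding pq(2)[symmetric] F_def G_def using False x ab(2) by auto
    qed
    then have "aff_dim H \<le> 1" using aff_dim_subset aff_dim_edge by metis
    then show ?thesis using assms(1) aff_dims(1) by (simp add: facet_of_def)
  qed
qed

theorem dihedral_angle: "dihedral_angle P (closed_segment p q) = arccos (- (m \<bullet> n))"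
proof -
  note mn = m(1) n(1) normals_not_parallel
  have nm: "(n \<bullet> m)\<^sup>2 \<noteq> 1" using normals_not_parallel by (simp add: inner_commute)
  have ez: "m \<bullet> z = c" "n \<bullet> z < c'" "n \<bullet> z' = c'" "m \<bullet> z' < c"
    using z m(2)[of z'] n(2)[of z] by (auto simp: F_def G_def order_less_le)
  have conv: "convex F" "convex G" "closed_segment p q \<subseteq> F" "closed_segment p q \<subseteq> G"
    using faces face_of_imp_convex pq(2) by blast+
  have F: "inward_direction (closed_segment p q) F u \<longleftrightarrow> u = inward_vector m n" for u
  proof
    assume "inward_direction (closed_segment p q) F u"
    then show "u = inward_vector m n"
      by (rule inward_direction_unique[OF mn pq(1), rotated -1])
        (use edge_normals n(2) in \<open>auto simp: F_def\<close>)
  next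
    assume "u = inward_vector m n"
    then show "inward_direction (closed_segment p q) F u"
      using inward_direction_exists[OF mn pq(1) _ conv(1,3) z(1) ez(1,2)] edge_normals by blast
  qed
  have G: "inward_direction (closed_segment p q) G u \<longleftrightarrow> u = inward_vector n m" for u
  proof
    assume "inward_direction (closed_segment p q) G u"
    then show "u = inward_vector n m"
      by (rule inward_direction_unique[OF n(1) m(1) nm pq(1), rotated -1])
        (use edge_normals m(2) in \<open>auto simp: G_def\<close>)
  next
    assume "u = inward_vector n m"
    then show "inward_direction (closed_segment p q) G u"
      using inward_direction_exists[OF n(1) m(1) nm pq(1) _ conv(2,4) z(3) ez(3,4)] edge_normals by blast
  qed
  have FG: "F \<noteq> G" using z by blast
  have ip: "inward_vector m n \<bullet> inward_vector n m = - (m \<bullet> n)"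
    "inward_vector n m \<bullet> inward_vector m n = - (m \<bullet> n)"
    using inward_vector_inner(4)[OF mn] by (simp_all add: inner_commute)
  show ?thesis
    unfolding dihedral_angle_def
  proof (rule the_equality)
    show "\<exists>F G u v. F facet_of P \<and> G facet_of P \<and> F \<noteq> G \<and>
        closed_segment p q \<subseteq> F \<and> closed_segment p q \<subseteq> G \<and>
        inward_direction (closed_segment p q) F u \<and> inward_direction (closed_segment p q) G v \<and>
        arccos (- (m \<bullet> n)) = arccos (u \<bullet> v)"
      using facets FG pq(2) F G ip(1) by (intro exI[of _ F] exI[of _ G]) auto
  next
    fix \<theta>
    assume "\<exists>F G u v. F facet_of P \<and> G facet_of P \<and> F \<noteq> G \<and>
        closed_segment p q \<subseteq> F \<and> closed_segment p q \<subseteq> G \<and>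
        inward_direction (closed_segment p q) F u \<and> inward_direction (closed_segment p q) G v \<and>
        \<theta> = arccos (u \<bullet> v)"
    then obtain H K u v where HK: "H facet_of P" "K facet_of P" "H \<noteq> K"
        "closed_segment p q \<subseteq> H" "closed_segment p q \<subseteq> K"
        "inward_direction (closed_segment p q) H u" "inward_direction (closed_segment p q) K v"
        "\<theta> = arccos (u \<bullet> v)" by blast
    \<comment> \<open>The description ranges over ordered pairs of facets; exchanging them leaves
      the inner product unchanged, so the angle is well defined.\<close>
    then have "H = F \<and> K = G \<or> H = G \<and> K = F" using facets_containing_edge by blast
    then show "\<theta> = arccos (- (m \<bullet> n))" using HK(6-8) F G ip by auto
  qed
qed

end

section \<open>Edges and dihedral angles of the pyramid\<close>

text \<open>Modulo 2 pi, the odd multiples of pi / n closest to 0 are pi / n and - pi / n, that is,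
  2 m + 1 is 1 or -1 modulo 2 n. This decides which base vertices lie on a lateral face.\<close>

lemma cos_odd_multiple:
  fixes n :: nat and m :: int
  assumes "n > 0"
  shows "cos ((2 * m + 1) * pi / n) \<le> cos (pi / n)"
    and "cos ((2 * m + 1) * pi / n) = cos (pi / n) \<Longrightarrow> int n dvd m \<or> int n dvd m + 1"
proof -
  define r t where "r = m mod int n" and "t = m div int n"
  have r: "0 \<le> r" "r < int n" using assms by (simp_all add: r_def)
  have m: "m = int n * t + r" by (simp add: r_def t_def)
  have "(2 * m + 1) * pi / n = (2 * r + 1) * pi / n + 2 * pi * t"
    using assms by (simp add: m field_simps)
  then have eq: "cos ((2 * m + 1) * pi / n) = cos ((2 * r + 1) * pi / n)"
    by (simp add: cos_add)
  \<comment> \<open>Reflecting x to 2 pi - x folds the angle into [0, pi], where the cosine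
    decreases.\<close>
  define s where "s = (if 2 * r + 1 \<le> int n then 2 * r + 1 else 2 * int n - (2 * r + 1))"
  have s: "1 \<le> s" "s \<le> int n" using r by (auto simp: s_def)
  have "cos (s * pi / n) = cos ((2 * r + 1) * pi / n)"
  proof (cases "2 * r + 1 \<le> int n")
    case False
    then have "s * pi / n = 2 * pi - (2 * r + 1) * pi / n" using assms by (simp add: s_def field_simps)
    then show ?thesis by (simp only: cos_2pi_minus)
  qed (simp add: s_def)
  then have cs: "cos ((2 * m + 1) * pi / n) = cos (s * pi / n)" using eq by simp
  have bounds: "0 \<le> pi / n" "pi / n \<le> s * pi / n" "s * pi / n \<le> pi"
    using s assms by (auto simp: divide_simps)
  show "cos ((2 * m + 1) * pi / n) \<le> cos (pi / n)"
    unfolding cs using bounds by (intro cos_monotone_0_pi_le) auto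
  assume "cos ((2 * m + 1) * pi / n) = cos (pi / n)"
  then have c: "cos (s * pi / n) = cos (pi / n)" unfolding cs .
  have "s = 1"
  proof (rule ccontr)
    assume "s \<noteq> 1"
    then have "pi / n * 1 < pi / n * s" using s assms by (intro mult_strict_left_mono) auto
    then have "pi / n < s * pi / n" by (simp add: mult.commute)
    from cos_monotone_0_pi[OF bounds(1) this bounds(3)] show False using c by simp
  qed
  then have "r = 0 \<or> r = int n - 1" using s r by (auto simp: s_def split: if_splits)
  then show "int n dvd m \<or> int n dvd m + 1" unfolding m by auto
qed

lemma face_of_convex_hull_eq:
  fixes V :: "'a::euclidean_space set"
  assumes "finite V" "T face_of convex hull V"
  shows "T = convex hull (V \<inter> T)"
proof -
  obtain U where U: "U \<subseteq> V" "T = convex hull U"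
    by (rule face_of_convex_hull_subset[OF finite_imp_compact[OF assms(1)] assms(2)])
  then have "U \<subseteq> V \<inter> T" by (simp add: hull_subset)
  then have "T \<subseteq> convex hull (V \<inter> T)" unfolding U(2)[symmetric] by (subst U(2)) (rule hull_mono)
  moreover have "convex hull (V \<inter> T) \<subseteq> T"
    using assms(2) by (intro hull_minimal) (auto dest: face_of_imp_convex)
  ultimately show ?thesis by blast
qed

lemma diameter_closed_segment:
  fixes a b :: "'a::euclidean_space"
  shows "diameter (closed_segment a b) = dist a b"
proof (rule antisym)
  show "diameter (closed_segment a b) \<le> dist a b"
  proof (rule diameter_le)
    fix x y assume "x \<in> closed_segment a b" "y \<in> closed_segment a b"
    then obtain s t where st: "0 \<le> s" "s \<le> 1" "x = (1 - s) *\<^sub>R a + s *\<^sub>R b"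
        "0 \<le> t" "t \<le> 1" "y = (1 - t) *\<^sub>R a + t *\<^sub>R b"
      unfolding in_segment by blast
    have "x - y = (t - s) *\<^sub>R (a - b)" unfolding st by (simp add: algebra_simps)
    then have "norm (x - y) = \<bar>t - s\<bar> * dist a b" by (simp add: dist_norm)
    also have "\<dots> \<le> 1 * dist a b" using st by (intro mult_right_mono) auto
    finally show "norm (x - y) \<le> dist a b" by simp
  qed simp
  show "dist a b \<le> diameter (closed_segment a b)"
    by (rule diameter_bounded_bound) (auto simp: bounded_closed_segment)
qed

locale regular_pyramid =
  fixes n :: nat and h :: real
  assumes n: "n \<ge> 3" and h: "h > 0"
begin

text \<open>Integer indices with period \<open>n\<close> let neighbours be written k - 1 and k + 1
  without wrap-around.\<close>

definition vertex :: "int \<Rightarrow> real^3" where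
  "vertex k = vector [cos (2 * pi * k / n), sin (2 * pi * k / n), 0]"

definition apex :: "real^3" where "apex = vector [0, 0, h]"

definition vertices :: "(real^3) set" where "vertices = insert apex (range vertex)"

text \<open>The inradius of the base is cos (pi / n), so this is the inclination of a lateral
  face.\<close>

definition base_angle :: real where "base_angle = arctan (h / cos (pi / n))"

text \<open>The outward unit normal over the edge from vertex k to vertex k + 1; its horizontal part
  points to the midpoint of that edge.\<close>

definition side_normal :: "int \<Rightarrow> real^3" where
  "side_normal k = vector [sin base_angle * cos ((2 * of_int k + 1) * pi / n),
     sin base_angle * sin ((2 * of_int k + 1) * pi / n), cos base_angle]"

definition side_offset :: real where "side_offset = h * cos base_angle"

definition base_normal :: "real^3" where "base_normal = vector [0, 0, - 1]"

abbreviation P :: "(real^3) set" where "P \<equiv> pyramid n h"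

lemma n_pos: "n > 0" "real n > 0" using n by auto

lemma inner_real3: "x \<bullet> y = x $ 1 * y $ 1 + x $ 2 * y $ 2 + x $ 3 * y $ 3" for x y :: "real^3"
  by (simp add: inner_vec_def sum_3)

lemma cos_pi_n: "cos (pi / n) > 0"
proof (rule cos_gt_zero)
  show "0 < pi / n" using n_pos by simp
  have "pi / n \<le> pi / 3" using n by (intro divide_left_mono) auto
  then show "pi / n < pi / 2" using pi_gt_zero by linarith
qed

lemma base_angle: "0 < base_angle" "base_angle < pi / 2" "tan base_angle = h / cos (pi / n)"
  using h cos_pi_n arctan_ubound by (simp_all only: base_angle_def zero_less_arctan_iff tan_arctan divide_pos_pos)

lemma cos_base_angle: "cos base_angle > 0" and sin_base_angle: "sin base_angle > 0"
  using base_angle(1,2) cos_gt_zero_pi[of base_angle] sin_gt_zero[of base_angle] by simp_all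

lemma side_offset_alt: "side_offset = sin base_angle * cos (pi / n)"
  using base_angle(3) cos_base_angle cos_pi_n by (simp add: side_offset_def tan_def field_simps)

lemma vertex_eq_iff: "vertex i = vertex j \<longleftrightarrow> int n dvd i - j"
proof
  assume "vertex i = vertex j"
  then have "cos (2 * pi * i / n) = cos (2 * pi * j / n)" "sin (2 * pi * i / n) = sin (2 * pi * j / n)"
    unfolding vertex_def by (metis vector_3(1), metis vector_3(2))
  then obtain k :: int where "2 * pi * i / n = 2 * pi * j / n + 2 * pi * k"
    using sin_cos_eq_iff by metis
  also have "\<dots> = 2 * pi * of_int (j + int n * k) / n" using n_pos by (simp add: field_simps)
  finally have "i = j + int n * k" using n_pos by (simp del: of_int_add of_int_mult)
  then show "int n dvd i - j" by simp
next
  assume "int n dvd i - j"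
  then obtain k where "i = j + int n * k" by (metis dvdE add.commute diff_add_cancel)
  then have "2 * pi * i / n = 2 * pi * j / n + 2 * pi * k" using n_pos by (simp add: field_simps)
  then show "vertex i = vertex j"
    unfolding vertex_def by (simp add: sin_add cos_add)
qed

lemma apex_neq_vertex: "apex \<noteq> vertex k"
proof
  assume "apex = vertex k"
  then have "apex $ 3 = vertex k $ 3" by simp
  then show False using h by (simp add: apex_def vertex_def)
qed

lemma vertex_mod: "vertex (k mod int n) = vertex k"
  unfolding vertex_eq_iff by (simp add: mod_eq_dvd_iff[symmetric])

lemma range_vertex: "range vertex = vertex ` {0..<int n}"
proof -
  have "vertex k \<in> vertex ` {0..<int n}" for k
    using n_pos by (intro image_eqI[of _ _ "k mod int n"]) (simp_all add: vertex_mod)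
  then show ?thesis by blast
qed

lemma finite_vertices: "finite vertices"
  by (simp add: vertices_def range_vertex)

lemma pyramid_eq: "P = convex hull vertices"
proof -
  have "{z :: complex. z ^ n = 1} = (\<lambda>k. cis (2 * pi * real k / real n)) ` {..<n}"
    using Complex.bij_betw_roots_unity[OF n_pos(1)] by (simp add: bij_betw_def)
  moreover have "{vector [Re z, Im z, 0] | z::complex. z ^ n = 1}
      = (\<lambda>z. vector [Re z, Im z, 0] :: real^3) ` {z. z ^ n = 1}" by blast
  ultimately have "{vector [Re z, Im z, 0] | z::complex. z ^ n = 1} = (\<lambda>k. vertex (int k)) ` {..<n}"
    by (simp add: image_image vertex_def)
  also have "\<dots> = vertex ` int ` {..<n}" by (simp add: image_image)
  also have "int ` {..<n} = {0..<int n}"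
    by (auto simp: image_iff) (metis lessThan_iff nat_0_le nat_less_iff)
  finally show ?thesis by (simp add: pyramid_def vertices_def apex_def range_vertex)
qed

lemma polytope_P: "polytope P"
  unfolding pyramid_eq by (rule polytope_convex_hull[OF finite_vertices])

lemma vertex_in_P: "vertex k \<in> P" "apex \<in> P"
  unfolding pyramid_eq by (auto intro!: hull_inc simp: vertices_def)

lemma halfspace:
  assumes "\<And>k. m \<bullet> vertex k \<le> c" "m \<bullet> apex \<le> c" "x \<in> P"
  shows "m \<bullet> x \<le> c"
proof -
  have "convex hull vertices \<subseteq> {x. m \<bullet> x \<le> c}"
    by (rule hull_minimal) (use assms in \<open>auto simp: vertices_def convex_halfspace_le\<close>)
  then show ?thesis using assms(3) unfolding pyramid_eq by blast
qed

lemma side_normal_vertex: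
  "side_normal k \<bullet> vertex j = sin base_angle * cos (of_int (2 * (k - j) + 1) * pi / n)"
proof -
  define x y where "x = (2 * of_int k + 1) * pi / n" and "y = 2 * pi * j / n"
  have eq: "of_int (2 * (k - j) + 1) * pi / n = x - y"
    by (simp add: x_def y_def diff_divide_distrib algebra_simps flip: add_divide_distrib)
  show ?thesis
    unfolding eq inner_real3 side_normal_def vertex_def x_def[symmetric] y_def[symmetric]
    by (simp add: cos_diff algebra_simps)
qed

lemma side_normal_vertex_le: "side_normal k \<bullet> vertex j \<le> side_offset"
  unfolding side_normal_vertex side_offset_alt
  using cos_odd_multiple(1)[OF n_pos(1), of "k - j"] sin_base_angle by simp

lemma side_normal_vertex_eq:
  "side_normal k \<bullet> vertex j = side_offset \<longleftrightarrow> vertex j = vertex k \<or> vertex j = vertex (k + 1)"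
proof
  assume "side_normal k \<bullet> vertex j = side_offset"
  then have "cos ((2 * (k - j) + 1) * pi / n) = cos (pi / n)"
    using sin_base_angle unfolding side_normal_vertex side_offset_alt by simp
  then have "int n dvd k - j \<or> int n dvd k - j + 1"
    using cos_odd_multiple(2)[OF n_pos(1), of "k - j"] by simp
  then show "vertex j = vertex k \<or> vertex j = vertex (k + 1)"
    unfolding vertex_eq_iff by (auto simp: algebra_simps dvd_diff_commute)
next
  have "side_normal k \<bullet> vertex k = side_offset"
    by (simp add: side_normal_vertex side_offset_alt)
  moreover have "side_normal k \<bullet> vertex (k + 1) = side_offset"
    unfolding side_normal_vertex side_offset_alt by simp
  moreover assume "vertex j = vertex k \<or> vertex j = vertex (k + 1)"
  ultimately show "side_normal k \<bullet> vertex j = side_offset" by auto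
qed

lemma side_normal_apex: "side_normal k \<bullet> apex = side_offset"
  unfolding inner_real3 side_normal_def apex_def side_offset_def by simp

lemma norm_side_normal: "norm (side_normal k) = 1"
proof -
  define x where "x = (2 * of_int k + 1) * pi / n"
  have "side_normal k \<bullet> side_normal k
      = (sin base_angle)\<^sup>2 * ((sin x)\<^sup>2 + (cos x)\<^sup>2) + (cos base_angle)\<^sup>2"
    unfolding inner_real3 side_normal_def x_def[symmetric] vector_3 by algebra
  also have "\<dots> = 1" by simp
  finally show ?thesis by (simp add: norm_eq_1)
qed

lemma norm_base_normal: "norm base_normal = 1"
  unfolding norm_eq_1 inner_real3 base_normal_def by simp

lemma base_normal_inner: "base_normal \<bullet> vertex k = 0" "base_normal \<bullet> apex = - h"
  unfolding inner_real3 base_normal_def vertex_def apex_def by simp_all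

lemma side_normal_le: "x \<in> P \<Longrightarrow> side_normal k \<bullet> x \<le> side_offset"
  using halfspace side_normal_vertex_le side_normal_apex by simp

lemma base_normal_le: "x \<in> P \<Longrightarrow> base_normal \<bullet> x \<le> 0"
  using halfspace[of base_normal 0] base_normal_inner h by simp

definition side :: "int \<Rightarrow> (real^3) set" where
  "side k = P \<inter> {x. side_normal k \<bullet> x = side_offset}"

definition base :: "(real^3) set" where
  "base = P \<inter> {x. base_normal \<bullet> x = 0}"

lemma convex_P: "convex P" by (rule polytope_imp_convex[OF polytope_P])

lemma side_face: "side k face_of P"
  unfolding side_def by (rule face_of_Int_supporting_hyperplane_le[OF convex_P side_normal_le])

lemma base_face: "base face_of P"
  unfolding base_def by (rule face_of_Int_supporting_hyperplane_le[OF convex_P base_normal_le])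

lemma mem_side: "vertex j \<in> side k \<longleftrightarrow> vertex j = vertex k \<or> vertex j = vertex (k + 1)" "apex \<in> side k"
  using vertex_in_P side_normal_vertex_eq side_normal_apex by (simp_all add: side_def)

lemma mem_base: "vertex j \<in> base" "apex \<notin> base"
  using vertex_in_P base_normal_inner h by (simp_all add: base_def)

lemma vertex_shift_neq:
  assumes "i - j \<in> {1, 2, -1, -2}"
  shows "vertex i \<noteq> vertex j"
proof -
  have "\<not> int n dvd i - j"
    using assms n zdvd_imp_le[of "int n" 1] zdvd_imp_le[of "int n" 2] by auto
  then show ?thesis by (simp add: vertex_eq_iff)
qed

lemma face_eq_segment:
  assumes "T face_of P" "vertices \<inter> T = {a, b}"
  shows "T = closed_segment a b"
  using face_of_convex_hull_eq[OF finite_vertices, of T] assms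
  by (simp add: pyramid_eq segment_convex_hull)

text \<open>That \<open>vertex (k + 2)\<close> is off the side uses n \<ge> 3, which keeps it
  distinct from both ends of the edge.\<close>

lemma base_edge_faces:
  "two_faces P base (side k) base_normal (side_normal k) 0 side_offset (vertex k) (vertex (k + 1))
     (vertex (k + 2)) apex"
proof
  show "base \<inter> side k = closed_segment (vertex k) (vertex (k + 1))"
  proof (rule face_eq_segment)
    show "base \<inter> side k face_of P" by (rule face_of_Int[OF base_face side_face])
    show "vertices \<inter> (base \<inter> side k) = {vertex k, vertex (k + 1)}"
      by (auto simp: vertices_def mem_side mem_base)
  qed
qed (auto simp: polytope_P norm_base_normal norm_side_normal base_normal_le side_normal_le base_def[symmetric]
    side_def[symmetric] mem_base mem_side vertex_shift_neq)

lemma lateral_edge_faces: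
  "two_faces P (side (k - 1)) (side k) (side_normal (k - 1)) (side_normal k) side_offset side_offset
     apex (vertex k) (vertex (k - 1)) (vertex (k + 1))"
proof
  show "side (k - 1) \<inter> side k = closed_segment apex (vertex k)"
  proof (rule face_eq_segment)
    show "side (k - 1) \<inter> side k face_of P" by (rule face_of_Int[OF side_face side_face])
    have "vertex (k - 1) \<noteq> vertex (k + 1)" by (rule vertex_shift_neq) simp
    then show "vertices \<inter> (side (k - 1) \<inter> side k) = {apex, vertex k}"
      by (auto simp: vertices_def mem_side)
  qed
qed (auto simp: polytope_P norm_side_normal side_normal_le side_def[symmetric] mem_side vertex_shift_neq
    apex_neq_vertex)

definition base_edge :: "int \<Rightarrow> (real^3) set" where
  "base_edge k = closed_segment (vertex k) (vertex (k + 1))"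

definition lateral_edge :: "int \<Rightarrow> (real^3) set" where
  "lateral_edge k = closed_segment apex (vertex k)"

definition lateral_angle :: real where
  "lateral_angle = arccos (- ((cos base_angle)\<^sup>2 + (sin base_angle)\<^sup>2 * cos (2 * pi / n)))"

lemma dihedral_angle_base_edge: "dihedral_angle P (base_edge k) = base_angle"
proof -
  have "base_normal \<bullet> side_normal k = - cos base_angle"
    unfolding inner_real3 base_normal_def side_normal_def by simp
  then have "dihedral_angle P (base_edge k) = arccos (cos base_angle)"
    unfolding base_edge_def two_faces.dihedral_angle[OF base_edge_faces] by simp
  also have "\<dots> = base_angle" using base_angle by (intro arccos_cos) auto
  finally show ?thesis .
qed

lemma dihedral_angle_lateral_edge: "dihedral_angle P (lateral_edge k) = lateral_angle"
proof -
  define x y where "x = (2 * of_int k + 1) * pi / n" and "y = (2 * of_int (k - 1) + 1) * pi / n"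
  have "x - y = 2 * pi / n"
    by (simp add: x_def y_def diff_divide_distrib[symmetric] algebra_simps)
  then have "cos (2 * pi / n) = cos x * cos y + sin x * sin y"
    by (metis cos_diff)
  then have "side_normal (k - 1) \<bullet> side_normal k = (cos base_angle)\<^sup>2 + (sin base_angle)\<^sup>2 * cos (2 * pi / n)"
    unfolding inner_real3 side_normal_def x_def[symmetric] y_def[symmetric]
    by (simp add: power2_eq_square algebra_simps)
  then show ?thesis
    unfolding lateral_edge_def two_faces.dihedral_angle[OF lateral_edge_faces] lateral_angle_def by simp
qed

lemma aff_dim_P: "aff_dim P = 3"
  by (rule two_faces.aff_dims(1)[OF base_edge_faces])

lemma interior_P: "interior P \<noteq> {}"
proof -
  have "rel_interior P \<noteq> {}"
    using convex_P vertex_in_P rel_interior_eq_empty by blast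
  moreover have "affine hull P = UNIV" using aff_dim_P aff_dim_eq_full[of P] by simp
  ultimately show ?thesis by (simp add: rel_interior_interior)
qed

text \<open>This rules out the diagonals of the base. On the vertices the functional is
  \<open>R\<close> times the cosine of the angular distance to a direction \<phi>, and two distinct
  maximisers are symmetric about \<phi>. If \<open>D\<close> is even, \<phi> points at a vertex,
  which would be the unique maximiser; if \<open>D\<close> is odd, \<phi> bisects an edge of the
  base, whose ends are the maximisers.\<close>

lemma adjacent_maximisers:
  assumes max: "\<And>k. a \<bullet> vertex k \<le> b" and i: "a \<bullet> vertex i = b" and j: "a \<bullet> vertex j = b"
    and "vertex i \<noteq> vertex j"
  obtains k where "a \<bullet> vertex k = b" "a \<bullet> vertex (k + 1) = b"
proof -
  define R \<phi> where "R = cmod (Complex (a $ 1) (a $ 2))" and "\<phi> = Arg (Complex (a $ 1) (a $ 2))"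
  have "Complex (a $ 1) (a $ 2) = rcis R \<phi>" unfolding R_def \<phi>_def by (rule rcis_cmod_Arg[symmetric])
  then have "a $ 1 = R * cos \<phi>" "a $ 2 = R * sin \<phi>"
    by (simp_all add: complex_eq_iff)
  then have f: "a \<bullet> vertex k = R * cos (2 * pi * k / n - \<phi>)" for k
    unfolding inner_real3 vertex_def by (simp add: cos_diff algebra_simps)
  show thesis
  proof (cases "R = 0")
    case True
    then show ?thesis using that[of i] i f by simp
  next
    case False
    then have "R > 0" by (simp add: R_def)
    moreover have "R * cos (2 * pi * i / n - \<phi>) = R * cos (2 * pi * j / n - \<phi>)"
      unfolding f[symmetric] i j ..
    ultimately have "cos (2 * pi * i / n - \<phi>) = cos (2 * pi * j / n - \<phi>)" by simp
    then obtain z where z: "z \<in> \<int>" "2 * pi * i / n - \<phi> = 2 * pi * j / n - \<phi> + 2 * z * pi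
        \<or> 2 * pi * i / n - \<phi> = - (2 * pi * j / n - \<phi>) + 2 * z * pi"
      unfolding cos_eq by blast
    then obtain m :: int where m: "2 * pi * i / n - \<phi> = 2 * pi * j / n - \<phi> + 2 * of_int m * pi
        \<or> 2 * pi * i / n - \<phi> = - (2 * pi * j / n - \<phi>) + 2 * of_int m * pi"
      by (auto elim: Ints_cases)
    have "2 * pi * i / n - \<phi> \<noteq> 2 * pi * j / n - \<phi> + 2 * of_int m * pi"
    proof
      assume "2 * pi * i / n - \<phi> = 2 * pi * j / n - \<phi> + 2 * of_int m * pi"
      then have "2 * pi * i / n = 2 * pi * of_int (j + int n * m) / n" using n_pos by (simp add: field_simps)
      then have "i = j + int n * m" using n_pos by (simp del: of_int_add of_int_mult)
      then show False using assms(4) by (simp add: vertex_eq_iff)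
    qed
    then have \<phi>: "2 * pi * i / n - \<phi> = - (2 * pi * j / n - \<phi>) + 2 * of_int m * pi" using m by blast
    define D where "D = i - j + int n * m"
    have "2 * \<phi> = 2 * ((i + j) * pi / n - of_int m * pi)"
      using \<phi> by (simp add: add_divide_distrib algebra_simps)
    then have "\<phi> = (i + j) * pi / n - of_int m * pi" by simp
    then have x: "2 * pi * (i + t) / n - \<phi> = (D + 2 * t) * pi / n" for t :: int
      using n_pos by (simp add: D_def field_simps)
    have le: "cos ((D + 2 * t) * pi / n) \<le> cos (D * pi / n)" for t :: int
    proof -
      have "a \<bullet> vertex (i + t) \<le> a \<bullet> vertex i" using max i by simp
      then show ?thesis using \<open>R > 0\<close> x[of t] x[of 0] by (simp add: f)
    qed
    show thesis
    proof (cases "even D")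
      case True
      then obtain c where c: "D = 2 * c" by (auto elim: evenE)
      have "cos (D * pi / n) \<ge> 1" using le[of "- c"] by (simp add: c)
      then have "cos (D * pi / n) = 1" using cos_le_one[of "D * pi / n"] by linarith
      then obtain e :: int where "D * pi / n = e * 2 * pi" by (auto simp: cos_one_2pi_int)
      also have "\<dots> = of_int (2 * int n * e) * pi / n" using n_pos by (simp add: field_simps)
      finally have "D = 2 * int n * e" using n_pos by (simp del: of_int_add of_int_mult)
      then have "i - j = int n * (2 * e - m)" by (simp add: D_def algebra_simps)
      then show ?thesis using assms(4) by (simp add: vertex_eq_iff)
    next
      case False
      then obtain c where c: "D = 2 * c + 1" by (auto elim: oddE)
      have "cos (pi / n) \<le> cos ((2 * c + 1) * pi / n)" using le[of "- c"] by (simp add: c)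
      then have "int n dvd c \<or> int n dvd c + 1"
        using cos_odd_multiple[OF n_pos(1), of c] by simp
      then show ?thesis
      proof
        assume "int n dvd c"
        then have "int n dvd 2 * c - int n * m" by simp
        moreover have "2 * c - int n * m = i - (j + 1)" using c by (simp add: D_def)
        ultimately have "vertex i = vertex (j + 1)" by (simp add: vertex_eq_iff)
        then show ?thesis using that[of j] i j by simp
      next
        assume "int n dvd c + 1"
        then have "int n dvd 2 * (c + 1)" by (rule dvd_mult)
        then have "int n dvd 2 * (c + 1) - int n * m" by (rule dvd_diff) simp
        moreover have "2 * (c + 1) - int n * m = i + 1 - j" using c by (simp add: D_def)
        ultimately have "vertex (i + 1) = vertex j" by (simp only: vertex_eq_iff)
        then show ?thesis using that[of i] i j by simp
      qed
    qed
  qed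
qed

lemma edge_of_subset_eq:
  assumes "e edge_of P" "f edge_of P" "f \<subseteq> e"
  shows "e = f"
proof (rule ccontr)
  assume "e \<noteq> f"
  have "f face_of e"
    by (rule face_of_subset[OF _ assms(3) edge_of_imp_subset[OF assms(1)]])
      (use assms(2) in \<open>simp add: edge_of_def\<close>)
  then have "aff_dim f < aff_dim e"
    using face_of_aff_dim_lt[of e f] \<open>e \<noteq> f\<close> assms(1) by (auto simp: edge_of_def dest: face_of_imp_convex)
  then show False using assms by (simp add: edge_of_def)
qed

text \<open>An edge is the hull of at least two vertices. If the apex is among them it contains a
  lateral edge; otherwise a functional exposing it has adjacent maximisers and it contains a base
  edge. Equal dimension forces equality.\<close>

lemma edge_of_iff: "e edge_of P \<longleftrightarrow> e \<in> range base_edge \<union> range lateral_edge"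
proof
  assume "e \<in> range base_edge \<union> range lateral_edge"
  then show "e edge_of P"
    using two_faces.edge[OF base_edge_faces] two_faces.edge[OF lateral_edge_faces]
    by (auto simp: base_edge_def lateral_edge_def)
next
  assume e: "e edge_of P"
  then have face: "e face_of P" and dim: "aff_dim e = 1" by (auto simp: edge_of_def)
  have conv: "convex e" using face by (rule face_of_imp_convex)
  have hull: "e = convex hull (vertices \<inter> e)"
    using face_of_convex_hull_eq[OF finite_vertices] face unfolding pyramid_eq by blast
  have two: "\<exists>y\<in>vertices \<inter> e. y \<noteq> x" for x
  proof (rule ccontr)
    assume "\<not> (\<exists>y\<in>vertices \<inter> e. y \<noteq> x)"
    then have "vertices \<inter> e \<subseteq> {x}" by blast
    then have "convex hull (vertices \<inter> e) \<subseteq> convex hull {x}" by (rule hull_mono)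
    then have "e \<subseteq> {x}" unfolding hull[symmetric] by simp
    then have "aff_dim e \<le> aff_dim {x}" by (rule aff_dim_subset)
    then show False using dim by simp
  qed
  show "e \<in> range base_edge \<union> range lateral_edge"
  proof (cases "apex \<in> e")
    case True
    obtain y where "y \<in> vertices \<inter> e" "y \<noteq> apex" using two by blast
    then obtain k where "vertex k \<in> e" by (auto simp: vertices_def)
    then have "lateral_edge k \<subseteq> e"
      unfolding lateral_edge_def using conv True by (simp add: closed_segment_subset)
    then have "e = lateral_edge k"
      using edge_of_subset_eq[OF e] two_faces.edge[OF lateral_edge_faces] by (simp add: lateral_edge_def)
    then show ?thesis by blast
  next
    case False
    obtain y where "y \<in> vertices \<inter> e" using two by blast
    then obtain i where i: "vertex i \<in> e" using False by (auto simp: vertices_def)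
    obtain y where "y \<in> vertices \<inter> e" "y \<noteq> vertex i" using two by blast
    then obtain j where j: "vertex j \<in> e" "vertex i \<noteq> vertex j" using False by (auto simp: vertices_def)
    have "e exposed_face_of P"
      using exposed_face_of_polyhedron[OF polytope_imp_polyhedron[OF polytope_P]] face by simp
    then obtain a b where ab: "P \<subseteq> {x. a \<bullet> x \<le> b}" "e = P \<inter> {x. a \<bullet> x = b}"
      by (auto simp: exposed_face_of_def)
    obtain k where "a \<bullet> vertex k = b" "a \<bullet> vertex (k + 1) = b"
      by (rule adjacent_maximisers[of a b i j]) (use ab i j vertex_in_P in auto)
    then have "vertex k \<in> e" "vertex (k + 1) \<in> e" using ab(2) vertex_in_P by simp_all
    then have "base_edge k \<subseteq> e"
      unfolding base_edge_def using conv by (simp add: closed_segment_subset)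
    then have "e = base_edge k"
      using edge_of_subset_eq[OF e] two_faces.edge[OF base_edge_faces] by (simp add: base_edge_def)
    then show ?thesis by blast
  qed
qed

lemma range_base_edge: "range base_edge = base_edge ` {0..<int n}"
  and range_lateral_edge: "range lateral_edge = lateral_edge ` {0..<int n}"
proof -
  have "vertex (k mod int n + 1) = vertex (k + 1)" for k
    using vertex_mod[of k] by (simp add: vertex_eq_iff)
  then have "base_edge (k mod int n) = base_edge k" "lateral_edge (k mod int n) = lateral_edge k" for k
    by (simp_all add: base_edge_def lateral_edge_def vertex_mod)
  then have "base_edge k \<in> base_edge ` {0..<int n}" "lateral_edge k \<in> lateral_edge ` {0..<int n}" for k
    using n_pos by (auto intro!: image_eqI[of _ _ "k mod int n"])
  then show "range base_edge = base_edge ` {0..<int n}" "range lateral_edge = lateral_edge ` {0..<int n}"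
    by blast+
qed

lemma inj_vertex: "inj_on vertex {0..<int n}"
proof (rule inj_onI)
  fix i j assume ij: "i \<in> {0..<int n}" "j \<in> {0..<int n}" "vertex i = vertex j"
  then have "int n dvd i - j" by (simp only: vertex_eq_iff)
  then have "i mod int n = j mod int n" by (simp only: mod_eq_dvd_iff)
  then show "i = j" using ij by simp
qed

lemma inj_base_edge: "inj_on base_edge {0..<int n}"
proof (rule inj_onI)
  fix i j assume ij: "i \<in> {0..<int n}" "j \<in> {0..<int n}" "base_edge i = base_edge j"
  then have "{vertex i, vertex (i + 1)} = {vertex j, vertex (j + 1)}" by (simp add: base_edge_def)
  \<comment> \<open>A segment determines its ends only as an unordered pair; the reversed matching
    would make \<open>n\<close> divide 2.\<close>
  moreover have "\<not> (vertex i = vertex (j + 1) \<and> vertex (i + 1) = vertex j)"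
  proof
    assume "vertex i = vertex (j + 1) \<and> vertex (i + 1) = vertex j"
    then have "int n dvd i - (j + 1)" "int n dvd i + 1 - j" by (simp_all add: vertex_eq_iff)
    then have "int n dvd (i + 1 - j) - (i - (j + 1))" by (rule dvd_diff[rotated])
    then have "int n dvd 2" by simp
    then show False using n zdvd_imp_le[of "int n" 2] by simp
  qed
  ultimately have "vertex i = vertex j" by (auto simp: doubleton_eq_iff)
  then show "i = j" using ij inj_vertex by (auto dest: inj_onD)
qed

lemma inj_lateral_edge: "inj_on lateral_edge {0..<int n}"
proof (rule inj_onI)
  fix i j assume ij: "i \<in> {0..<int n}" "j \<in> {0..<int n}" "lateral_edge i = lateral_edge j"
  then have "{apex, vertex i} = {apex, vertex j}" by (simp add: lateral_edge_def)
  then have "vertex i = vertex j" by (auto simp: doubleton_eq_iff)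
  then show "i = j" using ij inj_vertex by (auto dest: inj_onD)
qed

lemma edges_disjoint: "base_edge i \<noteq> lateral_edge j"
  by (simp add: base_edge_def lateral_edge_def doubleton_eq_iff apex_neq_vertex apex_neq_vertex[symmetric])

lemma diameter_base_edge: "diameter (base_edge k) = 2 * sin (pi / n)"
proof -
  define x y where "x = 2 * pi * k / n" and "y = 2 * pi * of_int (k + 1) / n"
  have yx: "y - x = 2 * (pi / n)" by (simp add: x_def y_def add_divide_distrib algebra_simps)
  have "(dist (vertex k) (vertex (k + 1)))\<^sup>2 = (cos x - cos y)\<^sup>2 + (sin x - sin y)\<^sup>2"
    unfolding dist_norm power2_norm_eq_inner inner_real3 vertex_def x_def y_def
    by (simp add: power2_eq_square)
  also have "\<dots> = ((sin x)\<^sup>2 + (cos x)\<^sup>2) + ((sin y)\<^sup>2 + (cos y)\<^sup>2) - 2 * cos (y - x)"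
    by (simp add: cos_diff power2_eq_square algebra_simps)
  also have "\<dots> = 2 - 2 * cos (2 * (pi / n))" unfolding yx by simp
  also have "\<dots> = (2 * sin (pi / n))\<^sup>2"
    unfolding cos_double_sin by (simp add: power_mult_distrib)
  finally have "dist (vertex k) (vertex (k + 1)) = 2 * sin (pi / n)"
  proof (rule power2_eq_imp_eq)
    have "pi / n \<le> pi / 1" using n by (intro divide_left_mono) auto
    then have "0 \<le> sin (pi / n)" by (intro sin_ge_zero) simp_all
    then show "0 \<le> 2 * sin (pi / n)" by simp
  qed simp
  then show ?thesis by (simp add: base_edge_def diameter_closed_segment)
qed

lemma diameter_lateral_edge: "diameter (lateral_edge k) = sqrt (1 + h\<^sup>2)"
proof -
  define x where "x = 2 * pi * k / n"
  have "(dist apex (vertex k))\<^sup>2 = ((sin x)\<^sup>2 + (cos x)\<^sup>2) + h\<^sup>2"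
    unfolding dist_norm power2_norm_eq_inner inner_real3 vertex_def x_def[symmetric] apex_def
      vector_minus_component vector_3 by algebra
  then have "(dist apex (vertex k))\<^sup>2 = 1 + h\<^sup>2" by simp
  then have "dist apex (vertex k) = sqrt (1 + h\<^sup>2)" by (metis real_sqrt_unique zero_le_dist)
  then show ?thesis by (simp add: lateral_edge_def diameter_closed_segment)
qed

section \<open>The Dehn invariant of the pyramid and the cases in which it vanishes\<close>

lemma sum_tensor_const:
  fixes x :: real
  assumes "finite A"
  shows "(\<Sum>k\<in>A. x \<otimes>\<^sub>\<int> y) = (real (card A) * x) \<otimes>\<^sub>\<int> y"
  using assms by induction (simp_all add: tensor_zero_left distrib_right tensor_add_left)

theorem dehn_pyramid:
  "dehn P = (n * (2 * sin (pi / n))) \<otimes>\<^sub>\<int> mod_pi base_angle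
     + (n * sqrt (1 + h\<^sup>2)) \<otimes>\<^sub>\<int> mod_pi lateral_angle"
proof -
  let ?t = "\<lambda>e. diameter e \<otimes>\<^sub>\<int> mod_pi (dihedral_angle P e)"
  have "{e. e edge_of P} = base_edge ` {0..<int n} \<union> lateral_edge ` {0..<int n}"
    unfolding edge_of_iff range_base_edge range_lateral_edge by blast
  then have "dehn P = sum ?t (base_edge ` {0..<int n} \<union> lateral_edge ` {0..<int n})"
    by (simp add: dehn_def)
  also have "\<dots> = sum ?t (base_edge ` {0..<int n}) + sum ?t (lateral_edge ` {0..<int n})"
    by (rule sum.union_disjoint) (use edges_disjoint in auto)
  finally show ?thesis
    by (simp add: sum.reindex[OF inj_base_edge] sum.reindex[OF inj_lateral_edge] diameter_base_edge
        diameter_lateral_edge dihedral_angle_base_edge dihedral_angle_lateral_edge sum_tensor_const)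
qed

theorem rational_pyramid_iff:
  "rational_polytope P \<longleftrightarrow> (\<exists>z\<in>\<rat>. base_angle = z * pi) \<and> (\<exists>z\<in>\<rat>. lateral_angle = z * pi)"
proof -
  have "rational_polytope P \<longleftrightarrow>
      (\<forall>k. \<exists>q\<in>\<rat>. dihedral_angle P (base_edge k) = q * pi) \<and>
      (\<forall>k. \<exists>q\<in>\<rat>. dihedral_angle P (lateral_edge k) = q * pi)"
    unfolding rational_polytope_def edge_of_iff by blast
  then show ?thesis by (simp add: dihedral_angle_base_edge dihedral_angle_lateral_edge)
qed

lemma cos_lateral_angle:
  "cos lateral_angle = - ((cos base_angle)\<^sup>2 + (sin base_angle)\<^sup>2 * cos (2 * pi / n))"
  and lateral_angle_bounds: "0 \<le> lateral_angle" "lateral_angle \<le> pi"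
proof -
  define C where "C = (cos base_angle)\<^sup>2 + (sin base_angle)\<^sup>2 * cos (2 * pi / n)"
  have "(sin base_angle)\<^sup>2 * cos (2 * pi / n) \<le> (sin base_angle)\<^sup>2 * 1"
    "(sin base_angle)\<^sup>2 * (- 1) \<le> (sin base_angle)\<^sup>2 * cos (2 * pi / n)"
    by (intro mult_left_mono; simp)+
  then have C: "- 1 \<le> - C" "- C \<le> 1"
    using sin_cos_squared_add[of base_angle] zero_le_power2[of "cos base_angle"]
    unfolding C_def by linarith+
  show "cos lateral_angle = - ((cos base_angle)\<^sup>2 + (sin base_angle)\<^sup>2 * cos (2 * pi / n))"
    "0 \<le> lateral_angle" "lateral_angle \<le> pi"
    unfolding lateral_angle_def C_def[symmetric] using C by (simp_all add: arccos_lbound arccos_ubound)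
qed

text \<open>An affine relation between two cosines, suited to the case of rational angles;
  \<open>cos_lateral_angle_tan\<close> is the form for commensurable lengths, where h^2 is
  known.\<close>

lemma cos_lateral_angle_double:
  "cos lateral_angle
     = - ((1 + cos (2 * base_angle)) / 2 + (1 - cos (2 * base_angle)) / 2 * cos (2 * pi / n))"
proof -
  have "(cos base_angle)\<^sup>2 = (1 + cos (2 * base_angle)) / 2" by (simp add: cos_double_cos)
  moreover have "(sin base_angle)\<^sup>2 = (1 - cos (2 * base_angle)) / 2" by (simp add: cos_double_sin)
  ultimately show ?thesis by (simp only: cos_lateral_angle)
qed

lemma cos_lateral_angle_tan:
  "cos lateral_angle = - (1 + (tan base_angle)\<^sup>2 * cos (2 * pi / n)) / (1 + (tan base_angle)\<^sup>2)"
proof -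
  have "1 + (tan base_angle)\<^sup>2 = 1 / (cos base_angle)\<^sup>2"
    using cos_base_angle tan_sec[of base_angle] by (simp add: inverse_eq_divide power_divide)
  moreover have "(sin base_angle)\<^sup>2 = (tan base_angle)\<^sup>2 * (cos base_angle)\<^sup>2"
    using cos_base_angle by (simp add: tan_def power_divide)
  ultimately show ?thesis unfolding cos_lateral_angle by (simp add: algebra_simps)
qed

text \<open>The ratio of the edge lengths is positive, so it is a reduced fraction of positive
  naturals. Multiplying by its denominator gives the integer coefficients that become exponents of
  the power products.\<close>

lemma dehn_zero_cases:
  assumes "dehn P = 0"
  obtains (rational) x y where "x \<in> \<rat>" "base_angle = x * pi" "y \<in> \<rat>" "lateral_angle = y * pi"
  | (commensurable) z :: real and p' q' :: nat
    where "p' > 0" "q' > 0" "coprime p' q'" "1 + h\<^sup>2 = (2 * sin (pi / n))\<^sup>2 * (p' / q')\<^sup>2"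
      "z \<in> \<rat>" "q' * base_angle + p' * lateral_angle = z * pi"
proof -
  have "pi / n < pi / 1" using n by (intro divide_strict_left_mono) auto
  then have s: "sin (pi / n) > 0" using n_pos by (intro sin_gt_zero) simp_all
  have "n * (2 * sin (pi / n)) \<noteq> 0" using s n_pos by simp
  from tensor_pair_vanishes[OF assms[unfolded dehn_pyramid] this] show thesis
  proof
    assume "(\<exists>z\<in>\<rat>. base_angle = z * pi) \<and> (\<exists>z\<in>\<rat>. lateral_angle = z * pi)"
    then show thesis using rational by blast
  next
    assume "\<exists>r\<in>\<rat>. n * sqrt (1 + h\<^sup>2) = r * (n * (2 * sin (pi / n))) \<and>
        (\<exists>z\<in>\<rat>. base_angle + r * lateral_angle = z * pi)"
    then obtain r z where r: "r \<in> \<rat>" "n * sqrt (1 + h\<^sup>2) = r * (n * (2 * sin (pi / n)))"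
        "z \<in> \<rat>" "base_angle + r * lateral_angle = z * pi" by blast
    have l: "sqrt (1 + h\<^sup>2) = r * (2 * sin (pi / n))" using r(2) n_pos by simp
    have "sqrt (1 + h\<^sup>2) > 0" by (simp add: add_pos_nonneg)
    then have "r > 0" using l s by (simp add: zero_less_mult_iff)
    then obtain p q :: nat where pq: "q \<noteq> 0" "r = p / q" "coprime p q"
      using Rats_abs_nat_div_natE[OF r(1)] by (metis abs_of_pos)
    show thesis
    proof (rule commensurable)
      show "p > 0" "q > 0" using pq(1,2) \<open>r > 0\<close> by (auto simp: zero_less_divide_iff)
      show "coprime p q" by (rule pq(3))
      have "1 + h\<^sup>2 = (sqrt (1 + h\<^sup>2))\<^sup>2" by simp
      also have "\<dots> = (2 * sin (pi / n))\<^sup>2 * (p / q)\<^sup>2" unfolding l pq(2) by (simp only: power_mult_distrib mult_ac)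
      finally show "1 + h\<^sup>2 = (2 * sin (pi / n))\<^sup>2 * (p / q)\<^sup>2" .
      show "q * z \<in> \<rat>" using r(3) by simp
      have "q * base_angle + p * lateral_angle = q * (base_angle + r * lateral_angle)"
        using pq(1,2) by (simp add: distrib_left)
      then show "q * base_angle + p * lateral_angle = q * z * pi" using r(4) by simp
    qed
  qed
qed

end

section \<open>The pyramids over the triangle, the square and the hexagon\<close>

lemma pi_fractions:
  "cos (2 * pi / real 3) = - 1 / 2" "cos (2 * pi / real 4) = 0" "cos (2 * pi / real 6) = 1 / 2"
  "cos (pi / real 3) = 1 / 2" "cos (pi / real 4) = sqrt 2 / 2" "cos (pi / real 6) = sqrt 3 / 2"
  "(2 * sin (pi / real 3))\<^sup>2 = 3" "(2 * sin (pi / real 4))\<^sup>2 = 2" "(2 * sin (pi / real 6))\<^sup>2 = 1"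
proof -
  have "2 * pi / 4 = pi / 2" "2 * pi / 6 = pi / 3" by simp_all
  then show "cos (2 * pi / real 4) = 0" "cos (2 * pi / real 6) = 1 / 2" by (simp_all add: cos_60)
qed (simp_all add: cos_120 cos_60 cos_45 cos_30 sin_60 sin_45 sin_30 power_divide power_mult_distrib)

theorem dehn_triangular_pyramid:
  assumes "h > 0"
  shows "dehn (pyramid 3 h) \<noteq> 0"
proof
  interpret regular_pyramid 3 h by standard (use assms in auto)
  have tan: "tan base_angle = 2 * h" using base_angle(3) unfolding pi_fractions by simp
  have double: "cos lateral_angle = - (1 + 3 * cos (2 * base_angle)) / 4"
    unfolding cos_lateral_angle_double pi_fractions by (simp add: field_simps)
  have cos: "cos lateral_angle = - (1 - 2 * h\<^sup>2) / (1 + 4 * h\<^sup>2)"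
    unfolding cos_lateral_angle_tan pi_fractions tan by (simp add: power_mult_distrib)
  assume "dehn (pyramid 3 h) = 0"
  then show False
  proof (cases rule: dehn_zero_cases)
    case (rational x y)
    \<comment> \<open>The term 3 cos (2 \<alpha>) in 4 cos \<beta> = - (1 + 3 cos (2 \<alpha>)) is
      split: one copy stands alone on the left, the other two form the integral 2 cos (2
      \<alpha>).\<close>
    have rel: "cos (2 * base_angle) = of_int (- 1) + of_int (- 2) * (2 * cos lateral_angle)
        + of_int (- 1) * (2 * cos (2 * base_angle))"
      using double by simp
    note quarter = rational_angle_quarter[OF rational base_angle(1,2) rel]
    have "2 * base_angle = pi / 2" using quarter(1) by simp
    then have "cos (2 * base_angle) = 0" by (simp only: cos_pi_half)
    then have "2 * cos lateral_angle = of_int (- 1) + 1 / 2" using double by simp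
    then show False using quarter(2) by blast
  next
    case (commensurable z p q)
    have "1 + h\<^sup>2 = 3 * (p / q)\<^sup>2"
      using commensurable(4) unfolding pi_fractions by simp
    from triangular_pyramid_angles[OF commensurable(1-3) assms this base_angle(1,2) tan
        lateral_angle_bounds cos commensurable(5)]
    show False using commensurable(6) by simp
  qed
qed

theorem dehn_hexagonal_pyramid:
  assumes "h > 0"
  shows "dehn (pyramid 6 h) \<noteq> 0"
proof
  interpret regular_pyramid 6 h by standard (use assms in auto)
  have tan: "tan base_angle = 2 * h / sqrt 3" using base_angle(3) unfolding pi_fractions by simp
  have double: "cos lateral_angle = - (3 + cos (2 * base_angle)) / 4"
    unfolding cos_lateral_angle_double pi_fractions by (simp add: field_simps)
  have "cos lateral_angle = - (1 + 4 * h\<^sup>2 / 3 * (1 / 2)) / (1 + 4 * h\<^sup>2 / 3)"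
    unfolding cos_lateral_angle_tan pi_fractions tan by (simp add: power_mult_distrib power_divide)
  also have "- (1 + 4 * h\<^sup>2 / 3 * (1 / 2)) = - (3 + 2 * h\<^sup>2) / 3" by (simp add: field_simps)
  also have "1 + 4 * h\<^sup>2 / 3 = (3 + 4 * h\<^sup>2) / 3" by (simp add: field_simps)
  also have "A / 3 / (B / 3) = A / B" for A B :: real by simp
  finally have cos: "cos lateral_angle = - (3 + 2 * h\<^sup>2) / (3 + 4 * h\<^sup>2)" .
  assume "dehn (pyramid 6 h) = 0"
  then show False
  proof (cases rule: dehn_zero_cases)
    case (rational x y)
    have rel: "cos (2 * base_angle) = of_int (- 3) + of_int (- 2) * (2 * cos lateral_angle)
        + of_int 0 * (2 * cos (2 * base_angle))"
      using double by simp
    note quarter = rational_angle_quarter[OF rational base_angle(1,2) rel]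
    have "2 * base_angle = pi / 2" using quarter(1) by simp
    then have "cos (2 * base_angle) = 0" by (simp only: cos_pi_half)
    then have "2 * cos lateral_angle = of_int (- 2) + 1 / 2" using double by simp
    then show False using quarter(2) by blast
  next
    case (commensurable z p q)
    have "1 + h\<^sup>2 = (p / q)\<^sup>2"
      using commensurable(4) unfolding pi_fractions by simp
    from hexagonal_pyramid_angles[OF commensurable(1-3) assms this base_angle(1,2) tan
        lateral_angle_bounds cos commensurable(5)]
    show False using commensurable(6) by simp
  qed
qed

theorem square_pyramid:
  assumes "h > 0"
  shows "rational_polytope (pyramid 4 h) \<longleftrightarrow> h = 1 / sqrt 2"
    and "dehn (pyramid 4 h) = 0 \<longleftrightarrow> h = 1 / sqrt 2"
proof -
  interpret regular_pyramid 4 h by standard (use assms in auto)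
  have "h / (sqrt 2 / 2) = sqrt 2 * h"
    using real_sqrt_mult_self[of 2] by (simp add: field_simps)
  then have tan: "tan base_angle = sqrt 2 * h" using base_angle(3) unfolding pi_fractions by simp
  have double: "cos lateral_angle = - (1 + cos (2 * base_angle)) / 2"
    unfolding cos_lateral_angle_double pi_fractions by (simp add: field_simps)
  have cos: "cos lateral_angle = - 1 / (1 + 2 * h\<^sup>2)"
    unfolding cos_lateral_angle_tan pi_fractions tan by (simp add: power_mult_distrib)
  have rational_imp: "h = 1 / sqrt 2"
    if "x \<in> \<rat>" "base_angle = x * pi" "y \<in> \<rat>" "lateral_angle = y * pi" for x y
  proof -
    have rel: "cos (2 * base_angle) = of_int (- 1) + of_int (- 1) * (2 * cos lateral_angle)
        + of_int 0 * (2 * cos (2 * base_angle))"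
      using double by simp
    have "base_angle = pi / 4" by (rule rational_angle_quarter(1)[OF that base_angle(1,2) rel])
    then have "tan base_angle = 1" by (simp only: tan_45)
    then have "sqrt 2 * h = 1" using tan by simp
    then show ?thesis by (simp add: field_simps)
  qed
  \<comment> \<open>This height is half the base side sqrt 2, so six copies fill a cube around its
    centre: half a right angle at the base, a third of a full turn along each half diagonal.\<close>
  have angles: "base_angle = 1 / 4 * pi" "lateral_angle = 2 / 3 * pi" if "h = 1 / sqrt 2"
  proof -
    have "tan base_angle = 1" using tan that by simp
    then show "base_angle = 1 / 4 * pi" using base_angle arctan_one arctan_unique[of base_angle 1] by simp
    have "cos lateral_angle = cos (2 * pi / 3)" using cos that by (simp add: cos_120 power_divide)
    then have "lateral_angle = 2 * pi / 3"
      by (intro cos_inj_pi[OF lateral_angle_bounds]) simp_all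
    then show "lateral_angle = 2 / 3 * pi" by simp
  qed
  have rats: "(1 / 4 :: real) \<in> \<rat>" "(2 / 3 :: real) \<in> \<rat>" by simp_all
  show "rational_polytope (pyramid 4 h) \<longleftrightarrow> h = 1 / sqrt 2"
    unfolding rational_pyramid_iff using rational_imp angles rats by blast
  show "dehn (pyramid 4 h) = 0 \<longleftrightarrow> h = 1 / sqrt 2"
  proof
    assume h: "h = 1 / sqrt 2"
    show "dehn (pyramid 4 h) = 0"
      unfolding dehn_pyramid angles(1)[OF h] angles(2)[OF h]
        tensor_rational_angle[OF rats(1)] tensor_rational_angle[OF rats(2)] by simp
  next
    assume "dehn (pyramid 4 h) = 0"
    then show "h = 1 / sqrt 2"
    proof (cases rule: dehn_zero_cases)
      case (rational x y)
      then show ?thesis by (rule rational_imp)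
    next
      case (commensurable z p q)
      have "1 + h\<^sup>2 = 2 * (p / q)\<^sup>2"
      using commensurable(4) unfolding pi_fractions by simp
    from square_pyramid_angles[OF commensurable(1-3) assms this base_angle(1,2) tan
        lateral_angle_bounds cos commensurable(5)]
    show ?thesis using commensurable(6) by simp
    qed
  qed
qed

theorem theorem1:
  shows "(\<forall>h::real. h > 0 \<longrightarrow>
            (dehn (pyramid 4 h) = 0 \<longleftrightarrow> h = 1 / sqrt 2) \<and>
            (rational_polytope (pyramid 4 h) \<longleftrightarrow> h = 1 / sqrt 2)) \<and>
         (\<forall>h::real. h > 0 \<longrightarrow> dehn (pyramid 3 h) \<noteq> 0 \<and> dehn (pyramid 6 h) \<noteq> 0) \<and>
         ((\<forall>P. polytope P \<and> interior P \<noteq> {} \<longrightarrow>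
               (scissor_equivalent_to_cube P \<longleftrightarrow> dehn P = 0)) \<longrightarrow>
          (\<forall>h::real. h > 0 \<longrightarrow>
             \<not> scissor_equivalent_to_cube (pyramid 3 h) \<and>
             \<not> scissor_equivalent_to_cube (pyramid 6 h)))"
proof -
  \<comment> \<open>The criterion assumed in the last conjunct concerns polytopes with nonempty
    interior, so the pyramids have to be recognised as such.\<close>
  have "polytope (pyramid n h) \<and> interior (pyramid n h) \<noteq> {}" if "n \<ge> 3" "h > 0" for n h
  proof -
    interpret regular_pyramid n h by standard (use that in auto)
    show ?thesis using polytope_P interior_P by blast
  qed
  then have "polytope (pyramid 3 h) \<and> interior (pyramid 3 h) \<noteq> {}"
    "polytope (pyramid 6 h) \<and> interior (pyramid 6 h) \<noteq> {}" if "h > 0" for h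
    using that by simp_all
  then show ?thesis
    using square_pyramid dehn_triangular_pyramid dehn_hexagonal_pyramid by simp
qed

end
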